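(* Let $\Delta$ be a finite abstract simplicial complex of dimension $d$ with $n$ facets ($d$-dimensional faces), and let $k$ be a nonnegative even integer. Then \[ \mathrm{Kir}_k(\Delta;x)=\bigl|\mathrm{Tor}(\tilde H_{d-1}(\Delta))\bigr|^k\sum_{\Gamma\text{ $0$-forest of }\Delta}\bigl|B_{d-1}(\Delta)/B_{d-1}(\Gamma)\bigr|^k\,x^{\Gamma_d}, \] where $x^{\Gamma_d}:=\prod_{\delta\in\Gamma_d}x_\delta$.
   Context: The faces of each dimension of $\Delta$ are enumerated, and $C_l(\Delta)$ is the free $\mathbb Z$-module on the $l$-faces, each simplex oriented by the order of its vertices given by the enumeration of vertices. $\partial_\Delta:C_d(\Delta)\to C_{d-1}(\Delta)$ is the $d$-th boundary map of the augmented simplicial chain complex, $\{i_0<\dots<i_d\}\mapsto\sum_j(-1)^j\{i_0,\dots,\widehat{i_j},\dots,i_d\}$; its matrix $U\in\mathcal M_{p,n}(\mathbb Z)$ in the bases of faces ($p$ = number of $(d-1)$-faces) is the $d$-th incidence matrix, with columns $u=(u_1,\dots,u_n)$ and rank $r$. $B_{d-1}(\Delta)=\mathrm{Im}(\partial_\Delta)$, $Z_d(\Delta)=\ker\partial_\Delta$, $\tilde H_{d-1}(\Delta)$ is the $(d-1)$-th reduced simplicial homology group with integer coefficients, and $\mathrm{Tor}$ denotes the torsion subgroup. Variables $x=(x_\delta)$ are indexed by facets. For $I=\{i_1<\dots<i_s\}$, $\|\mathbf u_I\|=\sqrt{\det(U_I^{\intercal}U_I)}$; for a submodule $A\subset\mathbb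 Z^p$ with basis $f$, $\|A\|=\|\mathbf f\|$; $a^0:=0$ if $a=0$, $1$ otherwise. $\mathrm{Kir}_k(\Delta;x):=\|\mathrm{span}(u)\cap\mathbb Z^p\|^{-k}\sum_{|I|=r}\|\mathbf u_I\|^k\prod_{i\in I}x_i$. A subcomplex $\Gamma\subset\Delta$ with the same $(d-1)$-skeleton as $\Delta$ is a $\kappa$-forest ($\kappa\ge0$ integer) if (1) $\Gamma$ has no nonzero $d$-cycle ($\ker\partial_\Gamma=0$), (2) $\mathrm{rk}(\partial_\Delta)-\mathrm{rk}(\partial_\Gamma)=\kappa$, and (3) $|\Gamma_d|=|\Delta_d|-\mathrm{rk}(Z_d(\Delta))-\kappa$, where $\Gamma_d$ is the set of facets of $\Gamma$ and $\partial_\Gamma$ its $d$-th boundary map. *)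

theory Defs
  imports
    "HOL-Algebra.Algebra"
    "HOL-Library.Poly_Mapping"
    "Jordan_Normal_Form.DL_Rank"
    "Jordan_Normal_Form.DL_Submatrix"
begin

section \<open>Abstract simplicial complexes and their augmented chain complex\<close>

text \<open>
  The empty face is a face of every nonempty complex, so the augmentation needs no separate
  treatment: dimensions are integers and the empty face has dimension \<open>-1\<close>. The family \<open>{}\<close>
  (without even the empty face) is allowed; it can only be a subcomplex that contains the full
  \<open>(d-1)\<close>-skeleton when \<open>d = -1\<close>. The linear order on the type of vertices is the enumeration of
  the vertices that orients the simplices.
\<close>

definition abstract_complex :: "'v set set \<Rightarrow> bool" where
  "abstract_complex K \<longleftrightarrow>
     finite K \<and> (\<forall>\<sigma>\<in>K. finite \<sigma>) \<and> (\<forall>\<sigma>\<in>K. \<forall>\<tau>. \<tau> \<subseteq> \<sigma> \<longrightarrow> \<tau> \<in> K)"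

definition face_dim :: "'v set \<Rightarrow> int" where
  "face_dim \<sigma> = int (card \<sigma>) - 1"

definition complex_dim :: "'v set set \<Rightarrow> int" where
  "complex_dim K = Max (face_dim ` K)"

definition faces :: "int \<Rightarrow> 'v set set \<Rightarrow> 'v set set" where
  "faces l K = {\<sigma>\<in>K. face_dim \<sigma> = l}"

definition skeleton :: "int \<Rightarrow> 'v set set \<Rightarrow> 'v set set" where
  "skeleton l K = {\<sigma>\<in>K. face_dim \<sigma> \<le> l}"

definition chain_group :: "int \<Rightarrow> 'v set set \<Rightarrow> ('v set \<Rightarrow>\<^sub>0 int) monoid" where
  "chain_group l K = free_Abelian_group (faces l K)"

definition face_boundary :: "'v::linorder set \<Rightarrow> 'v set \<Rightarrow>\<^sub>0 int" where
  "face_boundary \<sigma> =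
     (\<Sum>j<card \<sigma>. frag_cmul ((-1) ^ j) (frag_of (\<sigma> - {sorted_list_of_set \<sigma> ! j})))"

definition boundary :: "('v::linorder set \<Rightarrow>\<^sub>0 int) \<Rightarrow> 'v set \<Rightarrow>\<^sub>0 int" where
  "boundary = frag_extend face_boundary"

text \<open>\<open>cycles l K\<close> is $Z_l(K)$ and \<open>boundaries l K\<close> is $B_l(K)$.\<close>

definition cycles :: "int \<Rightarrow> 'v::linorder set set \<Rightarrow> ('v set \<Rightarrow>\<^sub>0 int) set" where
  "cycles l K = kernel (chain_group l K) (chain_group (l - 1) K) boundary"

definition boundaries :: "int \<Rightarrow> 'v::linorder set set \<Rightarrow> ('v set \<Rightarrow>\<^sub>0 int) set" where
  "boundaries l K = boundary ` carrier (chain_group (l + 1) K)"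

definition reduced_homology :: "int \<Rightarrow> 'v::linorder set set \<Rightarrow> ('v set \<Rightarrow>\<^sub>0 int) set monoid" where
  "reduced_homology l K = subgroup_generated (chain_group l K) (cycles l K) Mod boundaries l K"

definition torsion :: "('a, 'b) monoid_scheme \<Rightarrow> 'a set" where
  "torsion G = {g \<in> carrier G. \<exists>m::nat. 0 < m \<and> g [^]\<^bsub>G\<^esub> m = \<one>\<^bsub>G\<^esub>}"

text \<open>$B_l(K) / B_l(L)$ for a subcomplex \<open>L\<close> of \<open>K\<close>.\<close>

definition boundaries_quotient ::
    "int \<Rightarrow> 'v::linorder set set \<Rightarrow> 'v set set \<Rightarrow> ('v set \<Rightarrow>\<^sub>0 int) set monoid" where
  "boundaries_quotient l K L =
     subgroup_generated (chain_group l K) (boundaries l K) Mod boundaries l L"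

text \<open>The rank of a finitely generated group of chains: the maximal number of elements that are
  linearly independent over the integers.\<close>

definition chain_rank :: "('a \<Rightarrow>\<^sub>0 int) set \<Rightarrow> nat" where
  "chain_rank A = Max {card S |S. S \<subseteq> A \<and> finite S \<and> \<not> Modules.module.dependent frag_cmul S}"

definition boundary_rank :: "int \<Rightarrow> 'v::linorder set set \<Rightarrow> nat" where
  "boundary_rank l K = chain_rank (boundary ` carrier (chain_group l K))"

definition kappa_forest :: "nat \<Rightarrow> int \<Rightarrow> 'v::linorder set set \<Rightarrow> 'v set set \<Rightarrow> bool" where
  "kappa_forest \<kappa> d K L \<longleftrightarrow>
     abstract_complex L \<and> L \<subseteq> K \<and> skeleton (d - 1) L = skeleton (d - 1) K \<and>
     cycles d L = {0} \<and>
     int (boundary_rank d K) - int (boundary_rank d L) = int \<kappa> \<and>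
     int (card (faces d L)) = int (card (faces d K)) - int (chain_rank (cycles d K)) - int \<kappa>"


section \<open>Kirchhoff polynomials\<close>

definition enumerates :: "'a list \<Rightarrow> 'a set \<Rightarrow> bool" where
  "enumerates xs A \<longleftrightarrow> distinct xs \<and> set xs = A"

definition incidence_mat :: "'v::linorder set list \<Rightarrow> 'v set list \<Rightarrow> int mat" where
  "incidence_mat ridges facets =
     mat (length ridges) (length facets)
       (\<lambda>(i, j). Poly_Mapping.lookup (boundary (frag_of (facets ! j))) (ridges ! i))"

text \<open>The norm of the family of columns of a matrix; it is 1 for the empty family.\<close>

definition gram_norm :: "int mat \<Rightarrow> real" where
  "gram_norm F = sqrt (of_int (Determinant.det (transpose_mat F * F)))"

text \<open>The columns of \<open>F\<close> form a basis of the submodule \<open>A\<close> of the integer vectors of length \<open>p\<close>.\<close>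

definition basis_mat :: "nat \<Rightarrow> int mat \<Rightarrow> int vec set \<Rightarrow> bool" where
  "basis_mat p F A \<longleftrightarrow>
     dim_row F = p \<and> bij_betw (\<lambda>c. F *\<^sub>v c) (carrier_vec (dim_col F)) A"

definition lattice_norm :: "nat \<Rightarrow> int vec set \<Rightarrow> real" where
  "lattice_norm p A = gram_norm (SOME F. basis_mat p F A)"

text \<open>The integer points of the real span of the columns.\<close>

definition span_lattice :: "int mat \<Rightarrow> int vec set" where
  "span_lattice U =
     {v \<in> carrier_vec (dim_row U).
        map_vec real_of_int v \<in> vec_space.col_space (dim_row U) (map_mat real_of_int U)}"

definition mat_rank :: "int mat \<Rightarrow> nat" where
  "mat_rank U = vec_space.rank (dim_row U) (map_mat real_of_int U)"

text \<open>Powers with the convention that $a^0$ is 0 for $a = 0$. It matters for \<open>k = 0\<close>, where linearly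
  dependent families of columns must not contribute.\<close>

definition zpow :: "real \<Rightarrow> nat \<Rightarrow> real" where
  "zpow a k = (if a = 0 then 0 else a ^ k)"

text \<open>Polynomials with real coefficients in variables indexed by \<open>'a\<close>: finitely supported families
  of coefficients, indexed by monomials, which are finitely supported families of exponents.\<close>

type_synonym 'a mpoly = "('a \<Rightarrow>\<^sub>0 nat) \<Rightarrow>\<^sub>0 real"

definition poly_const :: "real \<Rightarrow> 'a mpoly" where
  "poly_const c = Poly_Mapping.single 0 c"

definition poly_var :: "'a \<Rightarrow> 'a mpoly" where
  "poly_var a = Poly_Mapping.single (Poly_Mapping.single a 1) 1"

definition kirchhoff_mat :: "nat \<Rightarrow> int mat \<Rightarrow> (nat \<Rightarrow> 'a mpoly) \<Rightarrow> 'a mpoly" where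
  "kirchhoff_mat k U x =
     poly_const (inverse (zpow (lattice_norm (dim_row U) (span_lattice U)) k)) *
     (\<Sum>I | I \<subseteq> {..<dim_col U} \<and> card I = mat_rank U.
        poly_const (zpow (gram_norm (submatrix U UNIV I)) k) * (\<Prod>i\<in>I. x i))"

definition kirchhoff :: "nat \<Rightarrow> 'v::linorder set list \<Rightarrow> 'v set list \<Rightarrow> 'v set mpoly" where
  "kirchhoff k ridges facets =
     kirchhoff_mat k (incidence_mat ridges facets) (\<lambda>i. poly_var (facets ! i))"

end

theory Submission
  imports Defs
begin

text \<open>
  Write $U$ for the incidence matrix, $B$ for the lattice spanned by its columns and
  $L = \mathrm{span}(U) \cap Z^p$ for the saturation of $B$. Choose bases $F$ of $L$ and $G$ of $B$.
  Both have $r$ columns, so $G = F M$ for a square integer matrix $M$ with nonzero determinant, and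
  for every set $I$ of $r$ columns $U_I = G N_I$ with $N_I$ square. Hence
  $\|U_I\| = |\det N_I| \cdot |\det M| \cdot \|F\|$. A square integer matrix with nonzero
  determinant spans a sublattice of index equal to the absolute value of its determinant, so
  $|\det M|$ is the order of $L/B$, which is the torsion of the homology because $L$ consists of the
  cycles having a multiple in $B$, and $|\det N_I|$ is the order of $B_{d-1}(\Delta)/B_{d-1}(\Gamma)$
  for the subcomplex $\Gamma$ with facets $I$. By rank-nullity these $\Gamma$ are $0$-forests exactly
  when the columns $U_I$ are independent; all other $I$ contribute nothing.
\<close>

section \<open>Subgroups of $Z^n$\<close>

text \<open>Determinants live in coordinates, whereas the group orders belong to quotients of chain
  groups. What passes between the two is a finite set of coset representatives rather than an
  isomorphism of quotients. The property \<open>transversal\<close> survives any suitably injective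
  map compatible with subtraction, so representatives are built once in Z^r, pushed through a basis
  matrix into Z^p, then through \<open>chain_of\<close> into chains, and only there counted as
  cosets. Independence of columns is phrased as a trivial integer kernel (\<open>inj_mat\<close>),
  so that kernel, determinant and dimension arguments stay over the integers. The reals enter
  through the norm, the span and the rank; the bridge is the Gram determinant, which is the same
  number over both rings. The matrices M and N_I are square because every lattice between B and its
  saturation spans the same real space, so each of its bases has r columns.\<close>

definition int_subgroup :: "nat \<Rightarrow> int vec set \<Rightarrow> bool" where
  "int_subgroup n A \<longleftrightarrow> A \<subseteq> carrier_vec n \<and> 0\<^sub>v n \<in> A \<and> (\<forall>u\<in>A. \<forall>v\<in>A. u - v \<in> A)"

definition col_lattice :: "int mat \<Rightarrow> int vec set" where
  "col_lattice F = (\<lambda>c. F *\<^sub>v c) ` carrier_vec (dim_col F)"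

text \<open>Linear independence of the columns as an indexed family, so repeated columns count as
  dependent.\<close>

definition inj_mat :: "int mat \<Rightarrow> bool" where
  "inj_mat F \<longleftrightarrow> (\<forall>c\<in>carrier_vec (dim_col F). F *\<^sub>v c = 0\<^sub>v (dim_row F) \<longrightarrow> c = 0\<^sub>v (dim_col F))"

text \<open>A complete system of coset representatives of \<open>A\<close> in \<open>B\<close>. Only
  subtraction is assumed of the type: vectors of varying length do not form a group type, and the
  same notion must serve vectors and chains.\<close>

definition transversal :: "'a::minus set \<Rightarrow> 'a set \<Rightarrow> 'a set \<Rightarrow> bool" where
  "transversal A B R \<longleftrightarrow> R \<subseteq> B \<and> (\<forall>v\<in>B. \<exists>!\<rho>. \<rho> \<in> R \<and> v - \<rho> \<in> A)"

lemma inj_mat_inj_on: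
  assumes "inj_mat F"
  shows "inj_on (\<lambda>c. F *\<^sub>v c) (carrier_vec (dim_col F))"
proof (rule inj_onI)
  fix x y assume xy: "x \<in> carrier_vec (dim_col F)" "y \<in> carrier_vec (dim_col F)" "F *\<^sub>v x = F *\<^sub>v y"
  have F: "F \<in> carrier_mat (dim_row F) (dim_col F)" by simp
  have "F *\<^sub>v (x - y) = F *\<^sub>v x - F *\<^sub>v y"
    using xy by (intro mult_minus_distrib_mat_vec[OF F]) auto
  hence "F *\<^sub>v (x - y) = 0\<^sub>v (dim_row F)" using xy by auto
  hence z: "x - y = 0\<^sub>v (dim_col F)" using assms xy unfolding inj_mat_def by auto
  show "x = y"
  proof (rule eq_vecI)
    fix i assume i: "i < dim_vec y"
    have "(x - y) $ i = 0" using z i xy by auto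
    thus "x $ i = y $ i" using i xy by auto
  qed (use xy in auto)
qed

lemma inj_mat_iff_inj_on:
  "inj_mat F \<longleftrightarrow> inj_on (\<lambda>c. F *\<^sub>v c) (carrier_vec (dim_col F))"
proof
  assume *: "inj_on (\<lambda>c. F *\<^sub>v c) (carrier_vec (dim_col F))"
  show "inj_mat F" unfolding inj_mat_def
  proof (intro ballI impI)
    fix c assume "c \<in> carrier_vec (dim_col F)" "F *\<^sub>v c = 0\<^sub>v (dim_row F)"
    moreover have "F *\<^sub>v 0\<^sub>v (dim_col F) = 0\<^sub>v (dim_row F)" by auto
    ultimately show "c = 0\<^sub>v (dim_col F)" using inj_onD[OF *] by auto
  qed
qed (rule inj_mat_inj_on)

lemma basis_mat_iff:
  "basis_mat p F A \<longleftrightarrow> dim_row F = p \<and> inj_mat F \<and> col_lattice F = A"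
  by (auto simp: basis_mat_def inj_mat_iff_inj_on col_lattice_def bij_betw_def)

lemma int_subgroup_col_lattice: "int_subgroup (dim_row F) (col_lattice F)"
  unfolding int_subgroup_def
proof (intro conjI ballI)
  show "col_lattice F \<subseteq> carrier_vec (dim_row F)"
    by (auto simp: col_lattice_def mult_mat_vec_carrier[OF carrier_matI[OF refl refl]])
  show "0\<^sub>v (dim_row F) \<in> col_lattice F" unfolding col_lattice_def
    by (rule image_eqI[of _ _ "0\<^sub>v (dim_col F)"]) auto
next
  fix u v assume "u \<in> col_lattice F" "v \<in> col_lattice F"
  then obtain x y where xy: "x \<in> carrier_vec (dim_col F)" "u = F *\<^sub>v x"
      "y \<in> carrier_vec (dim_col F)" "v = F *\<^sub>v y" unfolding col_lattice_def by auto
  have F: "F \<in> carrier_mat (dim_row F) (dim_col F)" by simp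
  have "u - v = F *\<^sub>v (x - y)" using xy mult_minus_distrib_mat_vec[OF F] by auto
  thus "u - v \<in> col_lattice F" unfolding col_lattice_def using xy by auto
qed

context
  fixes n A assumes A: "int_subgroup n A"
begin

lemma int_subgroup_carrier: "u \<in> A \<Longrightarrow> u \<in> carrier_vec n"
  using A by (auto simp: int_subgroup_def)

lemma int_subgroup_zero: "0\<^sub>v n \<in> A"
  using A by (auto simp: int_subgroup_def)

lemma int_subgroup_minus: "u \<in> A \<Longrightarrow> v \<in> A \<Longrightarrow> u - v \<in> A"
  using A by (auto simp: int_subgroup_def)

lemma int_subgroup_uminus: assumes "u \<in> A" shows "- u \<in> A"
proof -
  have "0\<^sub>v n - u = - u" using int_subgroup_carrier[OF assms] by auto
  thus ?thesis using int_subgroup_minus[OF int_subgroup_zero assms] by simp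
qed

lemma int_subgroup_add: assumes "u \<in> A" "v \<in> A" shows "u + v \<in> A"
proof -
  have "u - (- v) = u + v" using assms[THEN int_subgroup_carrier] by auto
  thus ?thesis using int_subgroup_minus[OF assms(1) int_subgroup_uminus[OF assms(2)]] by simp
qed

lemma int_subgroup_smult: assumes "u \<in> A" shows "k \<cdot>\<^sub>v u \<in> A"
proof -
  note u = int_subgroup_carrier[OF assms]
  have nat: "int m \<cdot>\<^sub>v u \<in> A" for m
  proof (induct m)
    case 0
    have "0 \<cdot>\<^sub>v u = 0\<^sub>v n" using u by auto
    thus ?case using int_subgroup_zero by simp
  next
    case (Suc m)
    have "int (Suc m) \<cdot>\<^sub>v u = int m \<cdot>\<^sub>v u + u" using u by (auto simp: algebra_simps)
    thus ?case using int_subgroup_add[OF Suc assms] by simp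
  qed
  show ?thesis
  proof (cases "k \<ge> 0")
    case True thus ?thesis using nat[of "nat k"] by simp
  next
    case False
    have "k \<cdot>\<^sub>v u = - (int (nat (- k)) \<cdot>\<^sub>v u)" using False u by auto
    thus ?thesis using int_subgroup_uminus[OF nat] by metis
  qed
qed

end

text \<open>Division with remainder by the least positive element. The trivial subgroup is covered
  by \<open>t = 0\<close>.\<close>

lemma int_subgroup_principal:
  fixes T :: "int set"
  assumes "0 \<in> T" and minus: "\<And>a b. a \<in> T \<Longrightarrow> b \<in> T \<Longrightarrow> a - b \<in> T"
  obtains t where "t \<in> T" and "\<And>a. a \<in> T \<Longrightarrow> t dvd a"
proof (cases "T = {0}")
  case True thus ?thesis using that[of 0] by auto
next
  case False
  then obtain b where b: "b \<in> T" "b \<noteq> 0" using assms(1) by auto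
  have um: "- a \<in> T" if "a \<in> T" for a using minus[OF assms(1) that] by simp
  have ad: "a + c \<in> T" if "a \<in> T" "c \<in> T" for a c using minus[OF that(1) um[OF that(2)]] by simp
  have mu: "int m * a \<in> T" if "a \<in> T" for a m
    by (induct m) (auto simp: assms(1) that ring_distribs ad)
  have mul: "k * a \<in> T" if "a \<in> T" for a k
  proof (cases "k \<ge> 0")
    case True thus ?thesis using mu[OF that, of "nat k"] by simp
  next
    case False thus ?thesis using um[OF mu[OF that, of "nat (-k)"]] by simp
  qed
  define P where "P m \<longleftrightarrow> m > 0 \<and> int m \<in> T" for m :: nat
  have "P (nat \<bar>b\<bar>)" using b um[of b] by (auto simp: P_def abs_if)
  hence L: "P (LEAST m. P m)" and min: "\<And>m. P m \<Longrightarrow> (LEAST m. P m) \<le> m"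
    by (auto intro: LeastI Least_le)
  define t where "t = int (LEAST m. P m)"
  have t: "t \<in> T" "t > 0" using L by (auto simp: P_def t_def)
  have "t dvd a" if a: "a \<in> T" for a
  proof (rule ccontr)
    assume "\<not> t dvd a"
    hence pos: "a mod t > 0" using t by (simp add: dvd_eq_mod_eq_0 order_less_le)
    have "a mod t = a - (a div t) * t" by (simp add: minus_div_mult_eq_mod)
    hence "a mod t \<in> T" using minus[OF a mul[OF t(1)]] by simp
    hence "P (nat (a mod t))" using pos by (auto simp: P_def)
    from min[OF this] have "t \<le> a mod t" using pos unfolding t_def by linarith
    thus False using pos_mod_bound[OF t(2), of a] by simp
  qed
  thus ?thesis using that t by blast
qed

section \<open>Triangular bases, one coordinate at a time\<close>

text \<open>The block lower triangular matrix with first column \<open>vCons t a\<close>, followed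
  by the columns of \<open>F\<close> with a 0 put in front.\<close>

definition col_extend :: "int \<Rightarrow> int vec \<Rightarrow> int mat \<Rightarrow> int mat" where
  "col_extend t a F =
     four_block_mat (mat 1 1 (\<lambda>_. t)) (0\<^sub>m 1 (dim_col F)) (mat (dim_row F) 1 (\<lambda>(i,_). a $ i)) F"

lemma dim_col_extend [simp]:
  "dim_row (col_extend t a F) = Suc (dim_row F)" "dim_col (col_extend t a F) = Suc (dim_col F)"
  by (auto simp: col_extend_def)

lemma col_extend_mult:
  assumes "a \<in> carrier_vec (dim_row F)" and "c \<in> carrier_vec (dim_col F)"
  shows "col_extend t a F *\<^sub>v vCons s c = vCons (s * t) (s \<cdot>\<^sub>v a + F *\<^sub>v c)"
proof (rule eq_vecI)
  fix i assume i: "i < dim_vec (vCons (s * t) (s \<cdot>\<^sub>v a + F *\<^sub>v c))"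
  show "(col_extend t a F *\<^sub>v vCons s c) $ i = vCons (s * t) (s \<cdot>\<^sub>v a + F *\<^sub>v c) $ i"
  proof (cases i)
    case 0
    have "row (col_extend t a F) 0 = vCons t (0\<^sub>v (dim_col F))"
      by (rule eq_vecI) (auto simp: col_extend_def vec_index_vCons)
    thus ?thesis using 0 assms by simp
  next
    case (Suc j)
    have "row (col_extend t a F) (Suc j) = vCons (a $ j) (row F j)"
      using Suc i assms by (intro eq_vecI) (auto simp: col_extend_def vec_index_vCons)
    thus ?thesis using Suc i assms by simp
  qed
qed (use assms in auto)

lemma det_col_extend:
  assumes "dim_row F = dim_col F"
  shows "det (col_extend t a F) = t * det F"
proof -
  have "det (mat 1 1 (\<lambda>_. t)) = t" by (subst det_single) auto
  moreover have "det (col_extend t a F) = det (mat 1 1 (\<lambda>_. t)) * det F"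
  proof -
    have "F \<in> carrier_mat (dim_col F) (dim_col F)" using assms by (intro carrier_matI) auto
    moreover have "mat (dim_row F) 1 (\<lambda>(i,_). a $ i) \<in> carrier_mat (dim_col F) 1" using assms by simp
    ultimately show ?thesis unfolding col_extend_def
      by (intro det_four_block_mat_upper_right_zero[of _ 1 _ "dim_col F"] mat_carrier refl)
  qed
  ultimately show ?thesis by simp
qed

definition zero_row :: "int mat \<Rightarrow> int mat" where
  "zero_row F = mat (Suc (dim_row F)) (dim_col F) (\<lambda>(i,j). if i = 0 then 0 else F $$ (i - 1, j))"

lemma zero_row_mult:
  assumes "c \<in> carrier_vec (dim_col F)"
  shows "zero_row F *\<^sub>v c = vCons 0 (F *\<^sub>v c)"
proof (rule eq_vecI)
  fix i assume i: "i < dim_vec (vCons 0 (F *\<^sub>v c))"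
  show "(zero_row F *\<^sub>v c) $ i = vCons 0 (F *\<^sub>v c) $ i"
  proof (cases i)
    case 0
    have "row (zero_row F) 0 = 0\<^sub>v (dim_col F)"
      by (rule eq_vecI) (auto simp: zero_row_def)
    thus ?thesis using 0 assms by (simp add: zero_row_def)
  next
    case (Suc j)
    have "row (zero_row F) (Suc j) = row F j"
      using Suc i assms by (intro eq_vecI) (auto simp: zero_row_def)
    thus ?thesis using Suc i assms by (simp add: zero_row_def)
  qed
qed (use assms in \<open>auto simp: zero_row_def\<close>)

lemma vCons_minus:
  "dim_vec u = dim_vec v \<Longrightarrow> vCons a u - vCons b v = vCons (a - b) (u - v)"
  by (rule eq_vecI) (auto simp: vec_index_vCons)

lemma vec_Suc_cases:
  assumes "v \<in> carrier_vec (Suc n)"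
  obtains a w where "v = vCons a w" "w \<in> carrier_vec n"
proof (cases v)
  case vNil
  thus ?thesis using assms by (auto dest: carrier_vecD intro: carrier_vecI)
next
  case (vCons a w)
  thus ?thesis using assms that by auto
qed

text \<open>The first coordinates of \<open>A\<close> are exactly the multiples of \<open>t\<close>.
  Subtracting a multiple of \<open>vCons t a\<close> therefore reduces the first coordinate to a
  residue, and what remains is a problem in the slice of \<open>A\<close> with first coordinate 0.
  Representatives are pairs of a residue and a representative for the slice.\<close>

lemma transversal_vCons:
  assumes A: "int_subgroup (Suc n) A" and t: "t \<noteq> 0" and a: "vCons t a \<in> A"
    and dv: "\<And>s w. vCons s w \<in> A \<Longrightarrow> t dvd s"
    and R: "transversal {w \<in> carrier_vec n. vCons 0 w \<in> A} (carrier_vec n) R"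
  shows "transversal A (carrier_vec (Suc n)) ((\<lambda>(s, \<rho>). vCons s \<rho>) ` ({0..<\<bar>t\<bar>} \<times> R))"
  unfolding transversal_def
proof (intro conjI ballI)
  note Rc = R[unfolded transversal_def, THEN conjunct1]
  note Ru = R[unfolded transversal_def, THEN conjunct2]
  have ac: "a \<in> carrier_vec n" using int_subgroup_carrier[OF A a] by simp
  show "(\<lambda>(s, \<rho>). vCons s \<rho>) ` ({0..<\<bar>t\<bar>} \<times> R) \<subseteq> carrier_vec (Suc n)"
    using Rc by auto
  fix v :: "int vec" assume "v \<in> carrier_vec (Suc n)"
  then obtain s w where v: "v = vCons s w" and w: "w \<in> carrier_vec n" by (rule vec_Suc_cases)
  \<comment> \<open>The modulus is the absolute value because \<open>t\<close> may be negative; the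
    quotient \<open>q\<close> below absorbs the sign.\<close>
  define s' where "s' = s mod \<bar>t\<bar>"
  have s': "s' \<in> {0..<\<bar>t\<bar>}" using t by (auto simp: s'_def)
  have "\<bar>t\<bar> dvd s - s'" unfolding s'_def by (simp add: mod_eq_dvd_iff[symmetric])
  then obtain q where q: "s - s' = q * t" by (metis abs_dvd_iff dvdE mult.commute)
  have "w - q \<cdot>\<^sub>v a \<in> carrier_vec n" using w ac by auto
  moreover have "w - q \<cdot>\<^sub>v a - \<rho> \<in> carrier_vec n" if "\<rho> \<in> R" for \<rho>
    using that w ac Rc by (auto simp: subset_iff)
  ultimately have "\<exists>!\<rho>. \<rho> \<in> R \<and> vCons 0 (w - q \<cdot>\<^sub>v a - \<rho>) \<in> A"
    using bspec[OF Ru, of "w - q \<cdot>\<^sub>v a"] by (simp cong: conj_cong)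
  then obtain \<rho> where \<rho>: "\<rho> \<in> R" "vCons 0 (w - q \<cdot>\<^sub>v a - \<rho>) \<in> A"
    and uni: "\<And>\<rho>'. \<rho>' \<in> R \<Longrightarrow> vCons 0 (w - q \<cdot>\<^sub>v a - \<rho>') \<in> A \<Longrightarrow> \<rho>' = \<rho>"
    by blast
  \<comment> \<open>Translation by \<open>q\<close> times the generator preserves \<open>A\<close>
    and turns the first coordinate \<open>q * t\<close> into 0.\<close>
  have key: "vCons (q * t) (w - \<rho>') \<in> A \<longleftrightarrow> vCons 0 (w - q \<cdot>\<^sub>v a - \<rho>') \<in> A" if "\<rho>' \<in> R" for \<rho>'
  proof -
    have \<rho>c: "\<rho>' \<in> carrier_vec n" using that Rc by auto
    have qa: "q \<cdot>\<^sub>v vCons t a \<in> A" by (rule int_subgroup_smult[OF A a])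
    have e1: "vCons (q * t) (w - \<rho>') - q \<cdot>\<^sub>v vCons t a = vCons 0 (w - q \<cdot>\<^sub>v a - \<rho>')"
      by (rule eq_vecI) (use w ac \<rho>c in \<open>auto simp: vec_index_vCons\<close>)
    have e2: "vCons 0 (w - q \<cdot>\<^sub>v a - \<rho>') + q \<cdot>\<^sub>v vCons t a = vCons (q * t) (w - \<rho>')"
      by (rule eq_vecI) (use w ac \<rho>c in \<open>auto simp: vec_index_vCons\<close>)
    show ?thesis using int_subgroup_minus[OF A _ qa] int_subgroup_add[OF A _ qa] e1 e2 by metis
  qed
  show "\<exists>!\<sigma>. \<sigma> \<in> (\<lambda>(s, \<rho>). vCons s \<rho>) ` ({0..<\<bar>t\<bar>} \<times> R) \<and> v - \<sigma> \<in> A"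
  proof (rule ex1I[of _ "vCons s' \<rho>"], intro conjI)
    show "vCons s' \<rho> \<in> (\<lambda>(s, \<rho>). vCons s \<rho>) ` ({0..<\<bar>t\<bar>} \<times> R)" using s' \<rho>(1) by auto
    have "v - vCons s' \<rho> = vCons (q * t) (w - \<rho>)"
      using v w \<rho>(1) Rc q by (subst v, subst vCons_minus) auto
    thus "v - vCons s' \<rho> \<in> A" using key[OF \<rho>(1)] \<rho>(2) by simp
  next
    fix \<sigma> assume \<sigma>: "\<sigma> \<in> (\<lambda>(s, \<rho>). vCons s \<rho>) ` ({0..<\<bar>t\<bar>} \<times> R) \<and> v - \<sigma> \<in> A"
    then obtain s'' \<rho>' where s'': "s'' \<in> {0..<\<bar>t\<bar>}" "\<rho>' \<in> R" "\<sigma> = vCons s'' \<rho>'" by auto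
    have e: "v - \<sigma> = vCons (s - s'') (w - \<rho>')"
      using v w s'' Rc by (simp, subst vCons_minus) auto
    hence "t dvd s - s''" using \<sigma> dv by metis
    hence "s'' mod \<bar>t\<bar> = s'" unfolding s'_def using mod_eq_dvd_iff abs_dvd_iff by metis
    hence ss: "s'' = s'" using s'' by simp
    hence "vCons 0 (w - q \<cdot>\<^sub>v a - \<rho>') \<in> A" using \<sigma> e q key[OF s''(2)] by simp
    thus "\<sigma> = vCons s' \<rho>" using uni s'' ss by auto
  qed
qed

text \<open>The induction splits off the first coordinate and so produces a triangular basis; the index claim
  rides along because it is immediate for triangular matrices.\<close>

lemma int_subgroup_basis_index:
  assumes "int_subgroup n A"
  shows "\<exists>F. dim_row F = n \<and> dim_col F \<le> n \<and> inj_mat F \<and> col_lattice F = A \<and>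
    (dim_col F = n \<longrightarrow> (\<exists>R. finite R \<and> int (card R) = \<bar>det F\<bar> \<and> transversal A (carrier_vec n) R))"
  using assms
proof (induct n arbitrary: A)
  case 0
  have z: "v = 0\<^sub>v 0" if "v \<in> carrier_vec 0" for v :: "int vec"
    using that by (intro eq_vecI) auto
  have A: "A = {0\<^sub>v 0}" using 0 z unfolding int_subgroup_def by blast
  have "transversal A (carrier_vec 0) {0\<^sub>v 0}" unfolding transversal_def A
    by (intro conjI ballI ex1I[of _ "0\<^sub>v 0"] singletonI) (use z in auto)
  moreover have "col_lattice (1\<^sub>m 0) = A" unfolding col_lattice_def A using z
    by (intro equalityI subsetI) (force, simp)
  moreover have "inj_mat (1\<^sub>m 0)" unfolding inj_mat_def using z by simp
  ultimately show ?case
    by (intro exI[of _ "1\<^sub>m 0"] conjI impI exI[of _ "{0\<^sub>v 0}"]) (simp_all add: det_one)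
next
  case (Suc n)
  define A' where "A' = {w \<in> carrier_vec n. vCons 0 w \<in> A}"
  have "int_subgroup n A'" unfolding int_subgroup_def
  proof (intro conjI ballI)
    show "0\<^sub>v n \<in> A'" using int_subgroup_zero[OF Suc.prems] by (auto simp: A'_def zero_vec_Suc)
    fix u v assume uv: "u \<in> A'" "v \<in> A'"
    have "vCons 0 u - vCons 0 v = vCons 0 (u - v)" using uv by (subst vCons_minus) (auto simp: A'_def)
    thus "u - v \<in> A'" using int_subgroup_minus[OF Suc.prems, of "vCons 0 u" "vCons 0 v"] uv
      by (auto simp: A'_def)
  qed (auto simp: A'_def)
  from Suc.hyps[OF this] obtain F where F: "dim_row F = n" "dim_col F \<le> n" "inj_mat F" "col_lattice F = A'"
    and R: "dim_col F = n \<longrightarrow> (\<exists>R. finite R \<and> int (card R) = \<bar>det F\<bar> \<and> transversal A' (carrier_vec n) R)" by auto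
  \<comment> \<open>The projection of \<open>A\<close> to the first coordinate, a subgroup of the
    integers. Its generator \<open>t\<close> together with one lift \<open>vCons t a\<close>
    complements the slice \<open>A'\<close>.\<close>
  define T where "T = {s. \<exists>w. vCons s w \<in> A}"
  have dimA: "dim_vec w = n" if "vCons s w \<in> A" for s w
    using int_subgroup_carrier[OF Suc.prems that] by auto
  have T0: "0 \<in> T" using int_subgroup_zero[OF Suc.prems] by (auto simp: T_def zero_vec_Suc)
  have Tm: "a - b \<in> T" if "a \<in> T" "b \<in> T" for a b
  proof -
    obtain u v where "vCons a u \<in> A" "vCons b v \<in> A" using \<open>a \<in> T\<close> \<open>b \<in> T\<close> by (auto simp: T_def)
    moreover from this have "vCons a u - vCons b v = vCons (a - b) (u - v)"
      using dimA by (intro vCons_minus) auto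
    ultimately have "vCons (a - b) (u - v) \<in> A" using int_subgroup_minus[OF Suc.prems] by metis
    thus ?thesis by (auto simp: T_def)
  qed
  obtain t where t: "t \<in> T" "\<And>a. a \<in> T \<Longrightarrow> t dvd a" using int_subgroup_principal[OF T0 Tm] by blast
  obtain a where a: "vCons t a \<in> A" using t by (auto simp: T_def)
  have ac: "a \<in> carrier_vec n" using dimA[OF a] by (auto dest: carrier_vecD intro: carrier_vecI)
  show ?case
  proof (cases "t = 0")
    \<comment> \<open>Every vector of \<open>A\<close> starts with 0, so the basis keeps at most
      \<open>n\<close> columns and the index claim, which is about \<open>Suc n\<close> columns, is
      vacuous.\<close>
    case True
    have 0: "s = 0" if "vCons s w \<in> A" for s w using t(2) that True by (auto simp: T_def)
    have "col_lattice (zero_row F) = A"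
    proof -
      have "col_lattice (zero_row F) = (\<lambda>c. vCons 0 (F *\<^sub>v c)) ` carrier_vec (dim_col F)"
        unfolding col_lattice_def by (rule image_cong) (auto simp: zero_row_mult, auto simp: zero_row_def)
      also have "\<dots> = vCons 0 ` A'" unfolding F(4)[symmetric] col_lattice_def by auto
      also have "\<dots> = A"
      proof (intro equalityI subsetI)
        fix v assume v: "v \<in> A"
        obtain s w where sw: "v = vCons s w" "w \<in> carrier_vec n"
          using vec_Suc_cases[OF int_subgroup_carrier[OF Suc.prems v]] by metis
        thus "v \<in> vCons 0 ` A'" using v 0[of s w] by (auto simp: A'_def)
      qed (auto simp: A'_def)
      finally show ?thesis .
    qed
    moreover have "inj_mat (zero_row F)"
      unfolding inj_mat_def
    proof (intro ballI impI)
      fix c assume c: "c \<in> carrier_vec (dim_col (zero_row F))"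
        "zero_row F *\<^sub>v c = 0\<^sub>v (dim_row (zero_row F))"
      have c': "c \<in> carrier_vec (dim_col F)" using c by (simp add: zero_row_def)
      have "vCons 0 (F *\<^sub>v c) = vCons 0 (0\<^sub>v (dim_row F))"
        using c(2) unfolding zero_row_mult[OF c'] by (simp add: zero_row_def zero_vec_Suc)
      thus "c = 0\<^sub>v (dim_col (zero_row F))"
        using F(3) c' unfolding inj_mat_def by (auto simp: zero_row_def)
    qed
    ultimately show ?thesis using F
      by (intro exI[of _ "zero_row F"]) (auto simp: zero_row_def)
  next
    case False
    let ?F = "col_extend t a F"
    have acF: "a \<in> carrier_vec (dim_row F)" using ac F by simp
    have "col_lattice ?F = A"
    proof (intro equalityI subsetI)
      fix v assume "v \<in> col_lattice ?F"
      then obtain s c where c: "c \<in> carrier_vec (dim_col F)" "v = ?F *\<^sub>v vCons s c"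
        unfolding col_lattice_def by (auto elim!: vec_Suc_cases)
      have v: "v = vCons (s * t) (s \<cdot>\<^sub>v a + F *\<^sub>v c)" using c col_extend_mult[OF acF c(1)] by simp
      have "F *\<^sub>v c \<in> A'" using F(4) c(1) by (auto simp: col_lattice_def)
      hence "vCons 0 (F *\<^sub>v c) \<in> A" by (simp add: A'_def)
      moreover have "s \<cdot>\<^sub>v vCons t a + vCons 0 (F *\<^sub>v c) = v"
        unfolding v by (rule eq_vecI) (use acF in \<open>auto simp: vec_index_vCons\<close>)
      ultimately show "v \<in> A" using int_subgroup_add[OF Suc.prems int_subgroup_smult[OF Suc.prems a]]
        by metis
    next
      fix v assume v: "v \<in> A"
      obtain s w where sw: "v = vCons s w" "w \<in> carrier_vec n"
        using vec_Suc_cases[OF int_subgroup_carrier[OF Suc.prems v]] by metis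
      obtain q where q: "s = q * t" using t(2)[of s] v sw by (auto simp: T_def dvd_def mult.commute)
      have "v - q \<cdot>\<^sub>v vCons t a \<in> A"
        using int_subgroup_minus[OF Suc.prems v int_subgroup_smult[OF Suc.prems a]] .
      moreover have "v - q \<cdot>\<^sub>v vCons t a = vCons 0 (w - q \<cdot>\<^sub>v a)"
        unfolding sw q by (rule eq_vecI) (use sw ac in \<open>auto simp: vec_index_vCons\<close>)
      ultimately have "w - q \<cdot>\<^sub>v a \<in> A'" using sw ac by (auto simp: A'_def)
      then obtain c where c: "c \<in> carrier_vec (dim_col F)" "w - q \<cdot>\<^sub>v a = F *\<^sub>v c"
        using F(4) by (auto simp: col_lattice_def)
      have "w = q \<cdot>\<^sub>v a + F *\<^sub>v c" unfolding c(2)[symmetric] using sw ac by auto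
      hence "v = ?F *\<^sub>v vCons q c" using col_extend_mult[OF acF c(1)] sw q by simp
      thus "v \<in> col_lattice ?F" unfolding col_lattice_def using c by auto
    qed
    moreover have "inj_mat ?F"
      unfolding inj_mat_def
    proof (intro ballI impI)
      fix z assume z: "z \<in> carrier_vec (dim_col ?F)" "?F *\<^sub>v z = 0\<^sub>v (dim_row ?F)"
      then obtain s c where c: "z = vCons s c" "c \<in> carrier_vec (dim_col F)"
        by (auto elim!: vec_Suc_cases)
      have e: "vCons (s * t) (s \<cdot>\<^sub>v a + F *\<^sub>v c) = vCons 0 (0\<^sub>v (dim_row F))"
        using z(2) unfolding c(1) col_extend_mult[OF acF c(2)] by (simp add: zero_vec_Suc)
      hence s: "s = 0" using False by simp
      have "s \<cdot>\<^sub>v a = 0\<^sub>v n" using s ac by auto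
      moreover have "F *\<^sub>v c \<in> carrier_vec n"
        using F(1) c(2) by (intro mult_mat_vec_carrier[of _ _ "dim_col F"]) auto
      ultimately have "F *\<^sub>v c = 0\<^sub>v (dim_row F)" using e F(1) by simp
      hence "c = 0\<^sub>v (dim_col F)" using F(3) c unfolding inj_mat_def by auto
      thus "z = 0\<^sub>v (dim_col ?F)" using c s by (simp add: zero_vec_Suc)
    qed
    \<comment> \<open>Here \<open>F\<close> has \<open>n\<close> columns, so the inductive index
      claim applies; the residues contribute the remaining factor, the absolute value of
      \<open>t\<close>.\<close>
    moreover have "\<exists>R. finite R \<and> int (card R) = \<bar>det ?F\<bar> \<and> transversal A (carrier_vec (Suc n)) R" if "dim_col ?F = Suc n"
    proof -
      obtain R where R: "finite R" "int (card R) = \<bar>det F\<bar>" "transversal A' (carrier_vec n) R" using R \<open>dim_col ?F = Suc n\<close> by auto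
      let ?R = "(\<lambda>(s, \<rho>). vCons s \<rho>) ` ({0..<\<bar>t\<bar>} \<times> R)"
      have "transversal A (carrier_vec (Suc n)) ?R"
        by (rule transversal_vCons[OF Suc.prems False a])
          (use t(2) R(3) in \<open>auto simp: T_def A'_def\<close>)
      moreover have "card ?R = card ({0..<\<bar>t\<bar>} \<times> R)" by (rule card_image) (auto simp: inj_on_def)
      moreover have "int (card ({0..<\<bar>t\<bar>} \<times> R)) = \<bar>det ?F\<bar>"
        using R(2) that F by (simp add: card_cartesian_product det_col_extend abs_mult)
      ultimately show ?thesis using R(1) by (intro exI[of _ ?R]) auto
    qed
    ultimately show ?thesis using F by (intro exI[of _ ?F]) auto
  qed
qed

section \<open>Norms, ranks and indices\<close>

lemma carrier_mat_dims [simp]: "F \<in> carrier_mat (dim_row F) (dim_col F)"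
  by (rule carrier_matI) auto

lemma scalar_prod_self_eq_0:
  fixes w :: "int vec"
  assumes "w \<in> carrier_vec n" and "w \<bullet> w = 0"
  shows "w = 0\<^sub>v n"
proof (rule eq_vecI)
  fix i assume i: "i < dim_vec (0\<^sub>v n :: int vec)"
  have "(\<Sum>i = 0..<dim_vec w. w $ i * w $ i) = 0" using assms(2) by (simp add: scalar_prod_def)
  hence "w $ i * w $ i = 0" using i assms(1)
    by (subst (asm) sum_nonneg_eq_0_iff) auto
  thus "w $ i = 0\<^sub>v n $ i" using i by simp
qed (use assms in auto)

text \<open>If the Gram matrix kills \<open>v\<close>, then the scalar product of \<open>F v\<close>
  with itself vanishes, hence \<open>F v = 0\<close>.\<close>

lemma det_gram_nonzero:
  assumes "inj_mat F"
  shows "det (F\<^sup>T * F) \<noteq> 0"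
proof
  let ?n = "dim_col F"
  have FF: "F\<^sup>T * F \<in> carrier_mat ?n ?n" by (rule mult_carrier_mat[of _ _ "dim_row F"]) auto
  assume "det (F\<^sup>T * F) = 0"
  then obtain v where v: "v \<in> carrier_vec ?n" "v \<noteq> 0\<^sub>v ?n" "(F\<^sup>T * F) *\<^sub>v v = 0\<^sub>v ?n"
    using det_0_iff_vec_prod_zero[OF FF] by auto
  have Fv: "F *\<^sub>v v \<in> carrier_vec (dim_row F)" using v by (intro mult_mat_vec_carrier[OF carrier_mat_dims])
  have FT: "F\<^sup>T \<in> carrier_mat ?n (dim_row F)" by simp
  have "F\<^sup>T *\<^sub>v (F *\<^sub>v v) = 0\<^sub>v ?n"
    using v(3) unfolding assoc_mult_mat_vec[OF FT carrier_mat_dims v(1)] .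
  moreover have "(F\<^sup>T *\<^sub>v (F *\<^sub>v v)) \<bullet> v = (F *\<^sub>v v) \<bullet> (F *\<^sub>v v)"
    by (rule transpose_vec_mult_scalar[OF carrier_mat_dims v(1) Fv])
  ultimately have "(F *\<^sub>v v) \<bullet> (F *\<^sub>v v) = 0" using v(1) by simp
  hence "F *\<^sub>v v = 0\<^sub>v (dim_row F)" by (rule scalar_prod_self_eq_0[OF Fv])
  thus False using assms v unfolding inj_mat_def by auto
qed

lemma gram_norm_nonzero: "inj_mat F \<Longrightarrow> gram_norm F \<noteq> 0"
  using det_gram_nonzero by (auto simp: gram_norm_def)

text \<open>The Gram matrix of \<open>F * Q\<close> is the Gram matrix of \<open>F\<close>
  multiplied by the transpose of \<open>Q\<close> on the left and by \<open>Q\<close> on the right.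
  For square \<open>Q\<close> its determinant gains the factor \<open>(det Q)^2\<close>.\<close>

lemma gram_norm_mult:
  assumes Q: "Q \<in> carrier_mat (dim_col F) (dim_col F)"
  shows "gram_norm (F * Q) = abs (real_of_int (Determinant.det Q)) * gram_norm F"
proof -
  let ?n = "dim_col F"
  have FF: "F\<^sup>T * F \<in> carrier_mat ?n ?n" by (rule mult_carrier_mat[of _ _ "dim_row F"]) auto
  have XT: "Q\<^sup>T \<in> carrier_mat ?n ?n" using Q by simp
  have T: "F\<^sup>T \<in> carrier_mat ?n (dim_row F)" by simp
  have "(F * Q)\<^sup>T * (F * Q) = (Q\<^sup>T * F\<^sup>T) * (F * Q)"
    by (subst transpose_mult[OF carrier_mat_dims Q]) simp
  also have "\<dots> = Q\<^sup>T * (F\<^sup>T * (F * Q))"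
    by (rule assoc_mult_mat[OF XT T mult_carrier_mat[OF carrier_mat_dims Q]])
  also have "\<dots> = Q\<^sup>T * ((F\<^sup>T * F) * Q)"
    by (subst assoc_mult_mat[OF T carrier_mat_dims Q]) simp
  finally have "det ((F * Q)\<^sup>T * (F * Q)) = det Q\<^sup>T * (det (F\<^sup>T * F) * det Q)"
    by (simp only: det_mult[OF XT mult_carrier_mat[OF FF Q]] det_mult[OF FF Q])
  hence "det ((F * Q)\<^sup>T * (F * Q)) = (det Q)\<^sup>2 * det (F\<^sup>T * F)"
    using det_transpose[OF Q] by (simp add: power2_eq_square)
  thus ?thesis by (simp add: gram_norm_def real_sqrt_mult)
qed

lemma inj_mat_iff_det:
  assumes "Q \<in> carrier_mat r r"
  shows "inj_mat Q \<longleftrightarrow> det Q \<noteq> 0"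
  using det_0_iff_vec_prod_zero[OF assms] assms unfolding inj_mat_def by auto

lemma inj_mat_mult:
  assumes "inj_mat F" and Q: "Q \<in> carrier_mat (dim_col F) k"
  shows "inj_mat (F * Q) \<longleftrightarrow> inj_mat Q"
proof -
  have "(F * Q) *\<^sub>v c = 0\<^sub>v (dim_row F) \<longleftrightarrow> Q *\<^sub>v c = 0\<^sub>v (dim_col F)" if c: "c \<in> carrier_vec k" for c
  proof -
    have "Q *\<^sub>v c \<in> carrier_vec (dim_col F)" by (rule mult_mat_vec_carrier[OF Q c])
    moreover have "F *\<^sub>v 0\<^sub>v (dim_col F) = 0\<^sub>v (dim_row F)" by auto
    ultimately show ?thesis using assms(1) assoc_mult_mat_vec[OF carrier_mat_dims Q c]
      unfolding inj_mat_def by metis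
  qed
  thus ?thesis using Q unfolding inj_mat_def by auto
qed

lemma inj_mat_multD:
  assumes "inj_mat (F * Q)" and Q: "Q \<in> carrier_mat (dim_col F) k"
  shows "inj_mat Q"
  unfolding inj_mat_def
proof (intro ballI impI)
  fix c assume c: "c \<in> carrier_vec (dim_col Q)" "Q *\<^sub>v c = 0\<^sub>v (dim_row Q)"
  have "(F * Q) *\<^sub>v c = F *\<^sub>v (Q *\<^sub>v c)"
    using c Q by (intro assoc_mult_mat_vec[OF carrier_mat_dims Q]) auto
  also have "\<dots> = 0\<^sub>v (dim_row F)" using c Q by auto
  finally show "c = 0\<^sub>v (dim_col Q)" using assms c unfolding inj_mat_def by auto
qed

text \<open>A matrix with more columns than rows becomes square when padded with zero rows. The
  padded matrix is singular, and over an integral domain a singular matrix has a nonzero kernel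
  vector.\<close>

lemma inj_mat_dim_le:
  assumes "inj_mat F"
  shows "dim_col F \<le> dim_row F"
proof (rule ccontr)
  let ?n = "dim_col F"
  assume "\<not> ?n \<le> dim_row F"
  hence lt: "dim_row F < ?n" by simp
  define H where "H = mat ?n ?n (\<lambda>(i,j). if i < dim_row F then F $$ (i,j) else 0)"
  have H: "H \<in> carrier_mat ?n ?n" by (simp add: H_def)
  have entry: "(H *\<^sub>v v) $ i = (if i < dim_row F then (F *\<^sub>v v) $ i else 0)"
    if "v \<in> carrier_vec ?n" "i < ?n" for v i
  proof -
    have "row H i = (if i < dim_row F then row F i else 0\<^sub>v ?n)"
      by (rule eq_vecI) (use \<open>i < ?n\<close> in \<open>auto simp: H_def\<close>)
    thus ?thesis using that H by (auto simp: H_def)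
  qed
  have "det H = 0"
  proof (rule ccontr)
    assume "det H \<noteq> 0"
    have "adj_mat H \<in> carrier_mat ?n ?n" "H * adj_mat H = det H \<cdot>\<^sub>m 1\<^sub>m ?n" using adj_mat[OF H] by auto
    \<comment> \<open>The last row of \<open>H\<close> is zero, while \<open>H * adj_mat H\<close>
      is \<open>det H\<close> times the identity. Reading off the last coordinate of
      \<open>H w\<close> in both ways forces \<open>det H = 0\<close>.\<close>
    define w where "w = adj_mat H *\<^sub>v unit_vec ?n (?n - 1)"
    have w: "w \<in> carrier_vec ?n" using adj_mat[OF H] by (simp add: w_def)
    have "H *\<^sub>v w = (H * adj_mat H) *\<^sub>v unit_vec ?n (?n - 1)"
      unfolding w_def using adj_mat[OF H] H by (subst assoc_mult_mat_vec[of _ ?n ?n _ ?n]) auto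
    also have "\<dots> = (det H \<cdot>\<^sub>m 1\<^sub>m ?n) *\<^sub>v unit_vec ?n (?n - 1)" using adj_mat[OF H] by simp
    finally have "(H *\<^sub>v w) $ (?n - 1) = ((det H \<cdot>\<^sub>m 1\<^sub>m ?n) *\<^sub>v unit_vec ?n (?n - 1)) $ (?n - 1)" by simp
    also have "\<dots> = det H" using lt by simp
    finally have "(H *\<^sub>v w) $ (?n - 1) = det H" .
    moreover have "\<not> ?n - 1 < dim_row F" "?n - 1 < ?n" using lt by auto
    ultimately show False using entry[OF w, of "?n - 1"] \<open>det H \<noteq> 0\<close> by simp
  qed
  then obtain v where v: "v \<in> carrier_vec ?n" "v \<noteq> 0\<^sub>v ?n" "H *\<^sub>v v = 0\<^sub>v ?n"
    using det_0_iff_vec_prod_zero[OF H] by auto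
  have "F *\<^sub>v v = 0\<^sub>v (dim_row F)"
  proof (rule eq_vecI)
    fix i assume i: "i < dim_vec (0\<^sub>v (dim_row F) :: int vec)"
    have "(H *\<^sub>v v) $ i = 0" using v(3) i lt by simp
    thus "(F *\<^sub>v v) $ i = 0\<^sub>v (dim_row F) $ i" using entry[OF v(1), of i] i lt by simp
  qed simp
  thus False using assms v unfolding inj_mat_def by auto
qed

lemma mult_unit_vec_col:
  fixes A :: "int mat"
  assumes "A \<in> carrier_mat nr nc" and "j < nc"
  shows "A *\<^sub>v unit_vec nc j = col A j"
  by (rule eq_vecI) (use assms in auto)

lemma col_in_col_lattice: "j < dim_col F \<Longrightarrow> col F j \<in> col_lattice F"
  unfolding col_lattice_def using mult_unit_vec_col[OF carrier_mat_dims, of j F]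
  by (metis image_eqI unit_vec_carrier)

text \<open>Coordinates of the columns of \<open>V\<close> with respect to \<open>F\<close> become
  the columns of \<open>Q\<close>. All passages between lattices go through such a
  factorization.\<close>

lemma col_lattice_factor:
  assumes "dim_row V = dim_row F" and "\<And>j. j < dim_col V \<Longrightarrow> col V j \<in> col_lattice F"
  obtains Q where "Q \<in> carrier_mat (dim_col F) (dim_col V)" and "V = F * Q"
proof -
  have "\<exists>c\<in>carrier_vec (dim_col F). F *\<^sub>v c = col V j" if "j < dim_col V" for j
    using assms(2)[OF that] unfolding col_lattice_def by auto
  then obtain x where x: "\<And>j. j < dim_col V \<Longrightarrow> x j \<in> carrier_vec (dim_col F) \<and> F *\<^sub>v x j = col V j"
    by metis
  define Q where "Q = mat_of_cols (dim_col F) (map x [0..<dim_col V])"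
  have Q: "Q \<in> carrier_mat (dim_col F) (dim_col V)"
    using mat_of_cols_carrier(1)[of "dim_col F" "map x [0..<dim_col V]"] by (simp add: Q_def)
  have colQ: "col Q j = x j" if "j < dim_col V" for j
    unfolding Q_def using that x by (subst col_mat_of_cols) auto
  have "V = F * Q"
  proof (rule mat_col_eqI)
    fix j assume "j < dim_col (F * Q)"
    hence j: "j < dim_col V" using Q by simp
    have "col (F * Q) j = F *\<^sub>v col Q j" by (rule col_mult2[OF carrier_mat_dims Q j])
    thus "col V j = col (F * Q) j" using x[OF j] colQ[OF j] by simp
  qed (use assms Q in auto)
  thus ?thesis using that Q by blast
qed

lemma col_lattice_mult:
  assumes Q: "Q \<in> carrier_mat (dim_col F) k"
  shows "col_lattice (F * Q) = (\<lambda>c. F *\<^sub>v c) ` col_lattice Q"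
proof -
  have "(F * Q) *\<^sub>v c = F *\<^sub>v (Q *\<^sub>v c)" if "c \<in> carrier_vec k" for c
    by (rule assoc_mult_mat_vec[OF carrier_mat_dims Q that])
  thus ?thesis using Q by (simp add: col_lattice_def image_image)
qed

lemma ex_basis_mat: "int_subgroup n A \<Longrightarrow> \<exists>F. basis_mat n F A"
  using int_subgroup_basis_index[of n A] by (auto simp: basis_mat_iff)

text \<open>The columns of \<open>Q\<close> and a triangular basis of the same lattice differ by a unimodular factor.\<close>

lemma ex_transversal_det:
  assumes Q: "Q \<in> carrier_mat r r" and det: "det Q \<noteq> 0"
  shows "\<exists>R. finite R \<and> int (card R) = \<bar>det Q\<bar> \<and> transversal (col_lattice Q) (carrier_vec r) R"
proof -
  have dX: "dim_row Q = r" "dim_col Q = r" using Q by auto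
  have "int_subgroup r (col_lattice Q)" using int_subgroup_col_lattice[of Q] dX by simp
  from int_subgroup_basis_index[OF this] obtain Y where Y: "dim_row Y = r" "dim_col Y \<le> r" "inj_mat Y"
      "col_lattice Y = col_lattice Q"
    and R: "dim_col Y = r \<Longrightarrow>
      \<exists>R. finite R \<and> int (card R) = \<bar>det Y\<bar> \<and> transversal (col_lattice Q) (carrier_vec r) R"
    by auto
  have colQ: "col Q j \<in> col_lattice Y" if "j < dim_col Q" for j
    using col_in_col_lattice[OF that] Y(4) by simp
  have colY: "col Y j \<in> col_lattice Q" if "j < dim_col Y" for j
    using col_in_col_lattice[OF that] Y(4) by simp
  obtain Z where Z: "Z \<in> carrier_mat (dim_col Y) (dim_col Q)" "Q = Y * Z"
    using col_lattice_factor[of Q Y, OF _ colQ] dX(1) Y(1) by metis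
  obtain W where W: "W \<in> carrier_mat (dim_col Q) (dim_col Y)" "Y = Q * W"
    using col_lattice_factor[of Y Q, OF _ colY] dX(1) Y(1) by metis
  \<comment> \<open>\<open>Y\<close> has at most \<open>r\<close> columns by construction.
    Injectivity of \<open>Z\<close>, which has \<open>r\<close> columns and as many rows as
    \<open>Y\<close> has columns, gives the opposite inequality, so all matrices are square.\<close>
  have "inj_mat Z" using inj_mat_multD[OF _ Z(1)] Z(2) inj_mat_iff_det[OF Q] det by simp
  hence "r \<le> dim_col Y" using inj_mat_dim_le[of Z] carrier_matD[OF Z(1)] dX(2) by simp
  hence dY: "dim_col Y = r" using Y(2) by simp
  have Yc: "Y \<in> carrier_mat r r" using Y(1) dY by (rule carrier_matI)
  have Zc: "Z \<in> carrier_mat r r" and Wc: "W \<in> carrier_mat r r" using Z(1) W(1) dX dY by simp_all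
  have e1: "det Q = det Y * det Z" using det_mult[OF Yc Zc] Z(2) by metis
  have e2: "det Y = det Q * det W" using det_mult[OF Q Wc] W(2) by metis
  have "det Q = det Q * (det W * det Z)" using e1 e2 by simp
  hence "det W * det Z = 1" using det by simp
  hence "\<bar>det Z\<bar> = 1" by (metis abs_mult abs_one mult.commute zmult_eq_1_iff abs_minus_cancel)
  hence "\<bar>det Q\<bar> = \<bar>det Y\<bar>" using e1 by (simp add: abs_mult)
  thus ?thesis using R[OF dY] by simp
qed

text \<open>Injectivity is required on a set \<open>D\<close> that also contains the differences, so
  that membership of a difference in \<open>A\<close> can be read off its image. Used for
  multiplication by a basis matrix and for \<open>chain_of\<close>.\<close>

lemma transversal_image:
  assumes R: "transversal A B R" and inj: "inj_on f D" and sub: "A \<subseteq> D" "B \<subseteq> D"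
    and minus: "\<And>u v. u \<in> B \<Longrightarrow> v \<in> B \<Longrightarrow> u - v \<in> D \<and> f u - f v = f (u - v)"
  shows "transversal (f ` A) (f ` B) (f ` R)" and "card (f ` R) = card R"
proof -
  have RB: "R \<subseteq> B" using R by (simp add: transversal_def)
  thus "card (f ` R) = card R" using sub by (intro card_image inj_on_subset[OF inj]) auto
  have iff: "f u - f v \<in> f ` A \<longleftrightarrow> u - v \<in> A" if "u \<in> B" "v \<in> B" for u v
    using minus[OF that] inj_on_image_mem_iff[OF inj _ sub(1), of "u - v"] by simp
  show "transversal (f ` A) (f ` B) (f ` R)"
    unfolding transversal_def
  proof (intro conjI ballI)
    show "f ` R \<subseteq> f ` B" using RB by auto
    fix u assume "u \<in> f ` B"
    then obtain v where v: "v \<in> B" "u = f v" by blast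
    obtain \<rho> where \<rho>: "\<rho> \<in> R" "v - \<rho> \<in> A"
      and uni: "\<And>\<rho>'. \<rho>' \<in> R \<Longrightarrow> v - \<rho>' \<in> A \<Longrightarrow> \<rho>' = \<rho>"
      using R v(1) unfolding transversal_def by metis
    show "\<exists>!\<sigma>. \<sigma> \<in> f ` R \<and> u - \<sigma> \<in> f ` A"
    proof (rule ex1I[of _ "f \<rho>"], intro conjI imageI)
      show "\<rho> \<in> R" by (rule \<rho>(1))
      show "u - f \<rho> \<in> f ` A"
        unfolding v(2) using iff[OF v(1), of \<rho>] \<rho> RB by blast
      fix \<sigma> assume \<sigma>: "\<sigma> \<in> f ` R \<and> u - \<sigma> \<in> f ` A"
      then obtain \<rho>' where \<rho>': "\<rho>' \<in> R" "\<sigma> = f \<rho>'" by blast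
      hence "v - \<rho>' \<in> A" using iff[OF v(1), of \<rho>'] \<sigma> RB v(2) by blast
      thus "\<sigma> = f \<rho>" using uni[OF \<rho>'(1)] \<rho>'(2) by simp
    qed
  qed
qed

text \<open>Multiplication by \<open>F\<close> carries the pair of Z^n and the column lattice of
  \<open>Q\<close> injectively to the two lattices in question.\<close>

lemma ex_transversal_mult:
  assumes F: "inj_mat F" and Q: "Q \<in> carrier_mat (dim_col F) (dim_col F)" and det: "det Q \<noteq> 0"
  shows "\<exists>R. finite R \<and> int (card R) = \<bar>det Q\<bar> \<and> transversal (col_lattice (F * Q)) (col_lattice F) R"
proof -
  let ?n = "dim_col F"
  obtain R where R: "finite R" "int (card R) = \<bar>det Q\<bar>" "transversal (col_lattice Q) (carrier_vec ?n) R"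
    using ex_transversal_det[OF Q det] by auto
  have sub: "col_lattice Q \<subseteq> carrier_vec ?n" using Q
    int_subgroup_carrier[OF int_subgroup_col_lattice[of Q]] by auto
  have minus: "u - v \<in> carrier_vec ?n \<and> F *\<^sub>v u - F *\<^sub>v v = F *\<^sub>v (u - v)"
    if "u \<in> carrier_vec ?n" "v \<in> carrier_vec ?n" for u v
    using mult_minus_distrib_mat_vec[OF carrier_mat_dims that] that by simp
  note img = transversal_image[OF R(3) inj_mat_inj_on[OF F] sub order_refl minus]
  show ?thesis
    unfolding col_lattice_mult[OF Q] using R(1,2) img
    by (intro exI[of _ "(\<lambda>c. F *\<^sub>v c) ` R"]) (simp add: col_lattice_def)
qed

section \<open>Real rank and saturated lattices\<close>

text \<open>A trivial integer kernel forces a trivial real kernel: a real kernel vector would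
  annihilate the real Gram matrix, whose determinant is the nonzero integer Gram
  determinant.\<close>

lemma mat_rank_inj_mat:
  assumes "inj_mat F"
  shows "mat_rank F = dim_col F"
proof -
  let ?h = "real_of_int" and ?n = "dim_col F" and ?p = "dim_row F"
  let ?F = "map_mat ?h F"
  have F: "?F \<in> carrier_mat ?p ?n" by simp
  have inj: "x = 0\<^sub>v ?n" if x: "x \<in> carrier_vec ?n" "?F *\<^sub>v x = 0\<^sub>v ?p" for x
  proof (rule ccontr)
    assume nz: "x \<noteq> 0\<^sub>v ?n"
    have c: "?F\<^sup>T * ?F \<in> carrier_mat ?n ?n" by (rule mult_carrier_mat[of _ _ ?p]) auto
    have "(?F\<^sup>T * ?F) *\<^sub>v x = ?F\<^sup>T *\<^sub>v (?F *\<^sub>v x)"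
      by (rule assoc_mult_mat_vec[OF _ F x(1)]) auto
    also have "\<dots> = 0\<^sub>v ?n" using x(2) by auto
    finally have "det (?F\<^sup>T * ?F) = 0" using det_0_iff_vec_prod_zero[OF c] x nz by auto
    moreover have "?F\<^sup>T * ?F = map_mat ?h (F\<^sup>T * F)"
      by (subst of_int_hom.mat_hom_mult[of "F\<^sup>T" ?n ?p F ?n]) (auto simp: map_mat_transpose)
    ultimately show False using det_gram_nonzero[OF assms] by simp
  qed
  \<comment> \<open>Independence below is that of the set of columns, so coincidences are excluded
    first; two equal columns would put a difference of unit vectors into the kernel.\<close>
  have dist: "distinct (cols ?F)"
    unfolding distinct_conv_nth
  proof (intro allI impI)
    fix i j assume ij: "i < length (cols ?F)" "j < length (cols ?F)" "i \<noteq> j"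
    show "cols ?F ! i \<noteq> cols ?F ! j"
    proof
      assume "cols ?F ! i = cols ?F ! j"
      hence c: "col ?F i = col ?F j" using ij by simp
      let ?x = "unit_vec ?n i - unit_vec ?n j :: real vec"
      have "?F *\<^sub>v ?x = ?F *\<^sub>v unit_vec ?n i - ?F *\<^sub>v unit_vec ?n j"
        by (rule mult_minus_distrib_mat_vec[OF F]) auto
      also have "\<dots> = col ?F i - col ?F j"
        using ij by (intro arg_cong2[of _ _ _ _ "(-)"] eq_vecI) auto
      also have "\<dots> = 0\<^sub>v ?p" using c by auto
      finally have "?x = 0\<^sub>v ?n" by (intro inj) auto
      hence "?x $ i = 0" using ij by simp
      thus False using ij by simp
    qed
  qed
  interpret vec_space "TYPE(real)" ?p .
  have "lin_indpt (set (cols ?F))"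
  proof
    assume "lin_dep (set (cols ?F))"
    from lin_depE[OF F this dist] obtain v where "v \<in> carrier_vec ?n" "v \<noteq> 0\<^sub>v ?n" "?F *\<^sub>v v = 0\<^sub>v ?p" .
    thus False using inj by auto
  qed
  thus ?thesis unfolding mat_rank_def by (rule lin_indpt_full_rank[OF F dist])
qed

definition real_col_space :: "int mat \<Rightarrow> real vec set" where
  "real_col_space U = (\<lambda>x. map_mat real_of_int U *\<^sub>v x) ` carrier_vec (dim_col U)"

lemma col_space_real:
  "vec_space.col_space (dim_row U) (map_mat real_of_int U) = real_col_space U"
proof -
  have U: "map_mat real_of_int U \<in> carrier_mat (dim_row U) (dim_col U)" by simp
  have d: "dim_row (map_mat real_of_int U) = dim_row U" "dim_col (map_mat real_of_int U) = dim_col U" by simp_all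
  show ?thesis unfolding vec_space.col_space_eq[OF U] real_col_space_def image_def d
    using mult_mat_vec_carrier[OF U] by blast
qed

lemma mat_rank_cong:
  assumes "dim_row U = dim_row V" and "real_col_space U = real_col_space V"
  shows "mat_rank U = mat_rank V"
  using assms col_space_real[of U] col_space_real[of V]
  unfolding mat_rank_def vec_space.rank_def vec_space.col_space_def by simp

lemma real_col_space_mult:
  assumes Q: "Q \<in> carrier_mat (dim_col F) k"
  shows "real_col_space (F * Q) \<subseteq> real_col_space F"
proof
  fix y assume "y \<in> real_col_space (F * Q)"
  then obtain x where x: "x \<in> carrier_vec k" "y = map_mat real_of_int (F * Q) *\<^sub>v x"
    using Q by (auto simp: real_col_space_def)
  have Q': "map_mat real_of_int Q \<in> carrier_mat (dim_col F) k" using Q by simp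
  have F': "map_mat real_of_int F \<in> carrier_mat (dim_row F) (dim_col F)" by simp
  have "y = map_mat real_of_int F *\<^sub>v (map_mat real_of_int Q *\<^sub>v x)"
    unfolding x(2) of_int_hom.mat_hom_mult[OF carrier_mat_dims Q]
    by (rule assoc_mult_mat_vec[OF F' Q' x(1)])
  thus "y \<in> real_col_space F" using mult_mat_vec_carrier[OF Q' x(1)] by (auto simp: real_col_space_def)
qed

lemma span_lattice_eq:
  "span_lattice U = {v \<in> carrier_vec (dim_row U). map_vec real_of_int v \<in> real_col_space U}"
  unfolding span_lattice_def col_space_real ..

lemma col_lattice_subset_span_lattice: "col_lattice U \<subseteq> span_lattice U"
proof
  fix v assume "v \<in> col_lattice U"
  then obtain c where c: "c \<in> carrier_vec (dim_col U)" "v = U *\<^sub>v c" by (auto simp: col_lattice_def)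
  have "map_vec real_of_int v = map_mat real_of_int U *\<^sub>v map_vec real_of_int c"
    unfolding c(2) by (rule of_int_hom.mult_mat_vec_hom[OF carrier_mat_dims c(1)])
  hence "map_vec real_of_int v \<in> real_col_space U"
    unfolding real_col_space_def using c(1) by simp
  moreover have "v \<in> carrier_vec (dim_row U)"
    unfolding c(2) by (rule mult_mat_vec_carrier[OF carrier_mat_dims c(1)])
  ultimately show "v \<in> span_lattice U" by (simp add: span_lattice_eq)
qed

lemma int_subgroup_span_lattice: "int_subgroup (dim_row U) (span_lattice U)"
  unfolding int_subgroup_def
proof (intro conjI ballI)
  show "span_lattice U \<subseteq> carrier_vec (dim_row U)" by (auto simp: span_lattice_def)
  show "0\<^sub>v (dim_row U) \<in> span_lattice U"
    using col_lattice_subset_span_lattice[of U] int_subgroup_zero[OF int_subgroup_col_lattice[of U]] by auto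
  fix u v assume uv: "u \<in> span_lattice U" "v \<in> span_lattice U"
  then obtain x y where xy: "x \<in> carrier_vec (dim_col U)" "map_vec real_of_int u = map_mat real_of_int U *\<^sub>v x"
      "y \<in> carrier_vec (dim_col U)" "map_vec real_of_int v = map_mat real_of_int U *\<^sub>v y"
    by (auto simp: span_lattice_eq real_col_space_def)
  have uvc: "u \<in> carrier_vec (dim_row U)" "v \<in> carrier_vec (dim_row U)"
    using uv by (auto simp: span_lattice_def)
  have F': "map_mat real_of_int U \<in> carrier_mat (dim_row U) (dim_col U)" by simp
  have "map_vec real_of_int (u - v) = map_vec real_of_int u - map_vec real_of_int v"
    by (rule eq_vecI) (use uvc in auto)
  also have "\<dots> = map_mat real_of_int U *\<^sub>v (x - y)"
    unfolding xy using mult_minus_distrib_mat_vec[OF F' xy(1,3)] by simp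
  finally show "u - v \<in> span_lattice U" using uvc xy by (auto simp: span_lattice_eq real_col_space_def)
qed

text \<open>Any lattice between the column lattice and its saturation spans the same real space as
  \<open>U\<close>. The statement serves both ends of this range.\<close>

lemma basis_mat_dim_col:
  assumes F: "basis_mat (dim_row U) F A" and A: "col_lattice U \<subseteq> A" "A \<subseteq> span_lattice U"
  shows "dim_col F = mat_rank U"
proof -
  have F: "dim_row F = dim_row U" "inj_mat F" "col_lattice F = A"
    using F by (auto simp: basis_mat_iff)
  have colU: "col U j \<in> col_lattice F" if "j < dim_col U" for j
    using col_in_col_lattice[OF that] A F(3) by auto
  obtain N where N: "N \<in> carrier_mat (dim_col F) (dim_col U)" "U = F * N"
    using col_lattice_factor[of U F, OF _ colU] F(1) by metis
  have "real_col_space U \<subseteq> real_col_space F" unfolding N(2) by (rule real_col_space_mult[OF N(1)])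
  moreover have "real_col_space F \<subseteq> real_col_space U"
  proof
    have cF: "map_vec real_of_int (col F j) \<in> real_col_space U" if "j < dim_col F" for j
      using col_in_col_lattice[OF that] F A by (auto simp: span_lattice_eq)
    have "\<exists>c\<in>carrier_vec (dim_col U). map_mat real_of_int U *\<^sub>v c = map_vec real_of_int (col F j)"
      if "j < dim_col F" for j
      using cF[OF that] unfolding real_col_space_def by (metis (no_types, lifting) imageE)
    then obtain x where x: "\<And>j. j < dim_col F \<Longrightarrow> x j \<in> carrier_vec (dim_col U) \<and>
        map_mat real_of_int U *\<^sub>v x j = map_vec real_of_int (col F j)" by metis
    \<comment> \<open>\<open>Q\<close> has real entries: vectors of \<open>A\<close> need not be
      integer combinations of the columns of \<open>U\<close>.\<close>
    define Q where "Q = mat_of_cols (dim_col U) (map x [0..<dim_col F])"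
    have Q: "Q \<in> carrier_mat (dim_col U) (dim_col F)"
      using mat_of_cols_carrier(1)[of "dim_col U" "map x [0..<dim_col F]"] by (simp add: Q_def)
    have colQ: "col Q j = x j" if "j < dim_col F" for j
      unfolding Q_def using that x by (subst col_mat_of_cols) auto
    have U': "map_mat real_of_int U \<in> carrier_mat (dim_row U) (dim_col U)" by simp
    have FQ: "map_mat real_of_int F = map_mat real_of_int U * Q"
    proof (rule mat_col_eqI)
      fix j assume "j < dim_col (map_mat real_of_int U * Q)"
      hence j: "j < dim_col F" using Q by simp
      have "col (map_mat real_of_int U * Q) j = map_mat real_of_int U *\<^sub>v col Q j"
        by (rule col_mult2[OF U' Q j])
      thus "col (map_mat real_of_int F) j = col (map_mat real_of_int U * Q) j"
        using x[OF j] colQ[OF j] j by simp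
    qed (use F Q in auto)
    fix y assume "y \<in> real_col_space F"
    then obtain z where z: "z \<in> carrier_vec (dim_col F)" "y = map_mat real_of_int F *\<^sub>v z"
      by (auto simp: real_col_space_def)
    have "y = map_mat real_of_int U *\<^sub>v (Q *\<^sub>v z)"
      unfolding z(2) FQ by (rule assoc_mult_mat_vec[OF U' Q z(1)])
    thus "y \<in> real_col_space U" using mult_mat_vec_carrier[OF Q z(1)] by (auto simp: real_col_space_def)
  qed
  ultimately have "mat_rank U = mat_rank F" using F by (intro mat_rank_cong) auto
  thus ?thesis using mat_rank_inj_mat[OF F(2)] by simp
qed

text \<open>The real span is closed under division by \<open>m\<close>. This places every cycle with
  a multiple among the boundaries into the saturation.\<close>

lemma span_lattice_saturated:
  assumes v: "v \<in> carrier_vec (dim_row U)" and m: "m \<noteq> 0" "m \<cdot>\<^sub>v v \<in> span_lattice U"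
  shows "v \<in> span_lattice U"
proof -
  obtain x where x: "x \<in> carrier_vec (dim_col U)"
    "map_vec real_of_int (m \<cdot>\<^sub>v v) = map_mat real_of_int U *\<^sub>v x"
    using m(2) by (auto simp: span_lattice_eq real_col_space_def)
  have U': "map_mat real_of_int U \<in> carrier_mat (dim_row U) (dim_col U)" by simp
  have "map_vec real_of_int v = (1 / real_of_int m) \<cdot>\<^sub>v map_vec real_of_int (m \<cdot>\<^sub>v v)"
    by (rule eq_vecI) (use m v in auto)
  also have "\<dots> = map_mat real_of_int U *\<^sub>v ((1 / real_of_int m) \<cdot>\<^sub>v x)"
    unfolding x(2) by (rule mult_mat_vec[OF U' x(1), symmetric])
  finally show ?thesis using v x(1) by (auto simp: span_lattice_eq real_col_space_def)
qed

text \<open>From \<open>Q * adj_mat Q = det Q * 1\<close>: the determinant annihilates the quotient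
  of the two lattices. It supplies the explicit multiplier that shows classes to be torsion.\<close>

lemma col_lattice_mult_det:
  assumes Q: "Q \<in> carrier_mat (dim_col F) (dim_col F)" and v: "v \<in> col_lattice F"
  shows "det Q \<cdot>\<^sub>v v \<in> col_lattice (F * Q)"
proof -
  obtain c where c: "c \<in> carrier_vec (dim_col F)" "v = F *\<^sub>v c" using v by (auto simp: col_lattice_def)
  note adj = adj_mat[OF Q]
  have "Q *\<^sub>v (adj_mat Q *\<^sub>v c) = (Q * adj_mat Q) *\<^sub>v c"
    by (rule assoc_mult_mat_vec[OF Q adj(1) c(1), symmetric])
  also have "\<dots> = (det Q \<cdot>\<^sub>m 1\<^sub>m (dim_col F)) *\<^sub>v c" using adj by simp
  also have "\<dots> = det Q \<cdot>\<^sub>v c"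
    by (rule eq_vecI) (use c in \<open>auto simp: row_smult smult_scalar_prod_distrib[of _ "dim_col F"]\<close>)
  finally have "det Q \<cdot>\<^sub>v c \<in> col_lattice Q"
    using mult_mat_vec_carrier[OF adj(1) c(1)] Q unfolding col_lattice_def by (metis carrier_matD(2) image_eqI)
  moreover have "det Q \<cdot>\<^sub>v v = F *\<^sub>v (det Q \<cdot>\<^sub>v c)"
    unfolding c(2) by (rule eq_vecI) (use c in \<open>auto simp: scalar_prod_smult_distrib[of _ "dim_col F"]\<close>)
  ultimately show ?thesis unfolding col_lattice_mult[OF Q] by auto
qed

section \<open>Chains in coordinates\<close>

text \<open>The coordinate map for the basis \<open>xs\<close>; on vectors of matching length and
  for distinct \<open>xs\<close> it is an isomorphism onto the chains supported on
  \<open>xs\<close>.\<close>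

definition chain_of :: "'a list \<Rightarrow> int vec \<Rightarrow> 'a \<Rightarrow>\<^sub>0 int" where
  "chain_of xs v = (\<Sum>i<length xs. frag_cmul (v $ i) (frag_of (xs ! i)))"

lemma lookup_sum_frag:
  "Poly_Mapping.lookup (\<Sum>i\<in>I. f i) x = (\<Sum>i\<in>I. Poly_Mapping.lookup (f i) x)"
  by (induct I rule: infinite_finite_induct) (auto simp: lookup_add)

lemma lookup_chain_of:
  "Poly_Mapping.lookup (chain_of xs v) x = (\<Sum>i<length xs. if xs ! i = x then v $ i else 0)"
  unfolding chain_of_def lookup_sum_frag by (rule sum.cong) auto

lemma lookup_chain_of_nth:
  assumes "distinct xs" and "i < length xs"
  shows "Poly_Mapping.lookup (chain_of xs v) (xs ! i) = v $ i"
proof -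
  have "(\<Sum>j<length xs. if xs ! j = xs ! i then v $ j else 0) = (\<Sum>j<length xs. if j = i then v $ j else 0)"
    using assms by (intro sum.cong refl) (auto simp: nth_eq_iff_index_eq)
  thus ?thesis using assms by (simp add: lookup_chain_of)
qed

lemma keys_chain_of: "Poly_Mapping.keys (chain_of xs v) \<subseteq> set xs"
proof
  fix x assume "x \<in> Poly_Mapping.keys (chain_of xs v)"
  hence "(\<Sum>i<length xs. if xs ! i = x then v $ i else 0) \<noteq> 0"
    by (simp add: in_keys_iff lookup_chain_of)
  then obtain i where i: "i \<in> {..<length xs}" "(if xs ! i = x then v $ i else 0) \<noteq> 0"
    by (rule sum.not_neutral_contains_not_neutral)
  thus "x \<in> set xs" by (auto split: if_splits)
qed

lemma chain_of_eqI:
  assumes "distinct xs" and "Poly_Mapping.keys c \<subseteq> set xs"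
    and "\<And>i. i < length xs \<Longrightarrow> Poly_Mapping.lookup c (xs ! i) = v $ i"
  shows "c = chain_of xs v"
proof (rule poly_mapping_eqI)
  fix x
  show "Poly_Mapping.lookup c x = Poly_Mapping.lookup (chain_of xs v) x"
  proof (cases "x \<in> set xs")
    case True
    then obtain i where "i < length xs" "x = xs ! i" by (auto simp: in_set_conv_nth)
    thus ?thesis using assms(3) lookup_chain_of_nth[OF assms(1)] by simp
  next
    case False
    thus ?thesis using assms(2) keys_chain_of[of xs v] by (metis in_keys_iff subsetD)
  qed
qed

lemma bij_betw_chain_of:
  assumes "distinct xs"
  shows "bij_betw (chain_of xs) (carrier_vec (length xs)) {c. Poly_Mapping.keys c \<subseteq> set xs}"
proof (rule bij_betw_imageI)
  show "inj_on (chain_of xs) (carrier_vec (length xs))"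
  proof (rule inj_onI)
    fix u v assume uv: "u \<in> carrier_vec (length xs)" "v \<in> carrier_vec (length xs)" "chain_of xs u = chain_of xs v"
    show "u = v"
    proof (rule eq_vecI)
      fix i assume "i < dim_vec v"
      thus "u $ i = v $ i" using uv lookup_chain_of_nth[OF assms] by (metis carrier_vecD)
    qed (use uv in auto)
  qed
  have "c \<in> chain_of xs ` carrier_vec (length xs)" if "Poly_Mapping.keys c \<subseteq> set xs" for c
  proof -
    let ?v = "vec (length xs) (\<lambda>i. Poly_Mapping.lookup c (xs ! i))"
    have "c = chain_of xs ?v" by (rule chain_of_eqI[OF assms that]) simp
    moreover have "?v \<in> carrier_vec (length xs)" by simp
    ultimately show ?thesis by (rule image_eqI)
  qed
  moreover have "chain_of xs v \<in> {c. Poly_Mapping.keys c \<subseteq> set xs}" for v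
    using keys_chain_of by (rule CollectI)
  ultimately show "chain_of xs ` carrier_vec (length xs) = {c. Poly_Mapping.keys c \<subseteq> set xs}"
    by (intro equalityI image_subsetI subsetI) (simp_all only: mem_Collect_eq)
qed

lemma chain_of_minus:
  assumes "u \<in> carrier_vec (length xs)" "v \<in> carrier_vec (length xs)"
  shows "chain_of xs (u - v) = chain_of xs u - chain_of xs v"
  unfolding chain_of_def sum_subtractf[symmetric] using assms
  by (intro sum.cong) (auto simp: frag_cmul_diff_distrib)

lemma chain_of_smult:
  assumes "u \<in> carrier_vec (length xs)"
  shows "chain_of xs (k \<cdot>\<^sub>v u) = frag_cmul k (chain_of xs u)"
  unfolding chain_of_def frag_cmul_sum using assms
  by (intro sum.cong) auto

lemma chain_of_zero: "chain_of xs (0\<^sub>v (length xs)) = 0"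
  unfolding chain_of_def by simp

lemma boundary_frag_of [simp]: "boundary (frag_of \<sigma>) = face_boundary \<sigma>"
  by (simp add: boundary_def)

lemma boundary_chain_of:
  assumes rs: "distinct rs" and keys: "\<And>f. f \<in> set fs \<Longrightarrow> Poly_Mapping.keys (face_boundary f) \<subseteq> set rs"
    and v: "v \<in> carrier_vec (length fs)"
  shows "boundary (chain_of fs v) = chain_of rs (incidence_mat rs fs *\<^sub>v v)"
proof -
  have bd: "boundary (chain_of fs v) = (\<Sum>j<length fs. frag_cmul (v $ j) (face_boundary (fs ! j)))"
    unfolding chain_of_def boundary_def by (simp add: frag_extend_sum frag_extend_cmul)
  show ?thesis
  proof (rule chain_of_eqI[OF rs])
    show "Poly_Mapping.keys (boundary (chain_of fs v)) \<subseteq> set rs"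
      unfolding bd
      by (rule order_trans[OF keys_sum], rule UN_least, rule order_trans[OF keys_cmul], rule keys) simp
    fix i assume i: "i < length rs"
    have "Poly_Mapping.lookup (boundary (chain_of fs v)) (rs ! i) =
        (\<Sum>j<length fs. v $ j * Poly_Mapping.lookup (face_boundary (fs ! j)) (rs ! i))"
      unfolding bd lookup_sum_frag by simp
    also have "\<dots> = (incidence_mat rs fs *\<^sub>v v) $ i"
      using i v by (simp add: incidence_mat_def scalar_prod_def atLeast0LessThan mult.commute)
    finally show "Poly_Mapping.lookup (boundary (chain_of fs v)) (rs ! i) = (incidence_mat rs fs *\<^sub>v v) $ i" .
  qed
qed

text \<open>Indexing the summands of the boundary by vertices instead of positions makes the proof that the
  boundary squares to zero an antisymmetry argument.\<close>

definition below :: "'v::linorder \<Rightarrow> 'v set \<Rightarrow> nat" where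
  "below v \<sigma> = card {w \<in> \<sigma>. w < v}"

text \<open>In a strictly sorted list the position of an entry is the number of smaller
  entries.\<close>

lemma face_boundary_below:
  assumes "finite \<sigma>"
  shows "face_boundary \<sigma> = (\<Sum>v\<in>\<sigma>. frag_cmul ((-1) ^ below v \<sigma>) (frag_of (\<sigma> - {v})))"
proof -
  let ?s = "sorted_list_of_set \<sigma>"
  have len: "length ?s = card \<sigma>" and st: "set ?s = \<sigma>" using assms by auto
  have bij: "bij_betw (\<lambda>j. ?s ! j) {..<card \<sigma>} \<sigma>"
    using bij_betw_nth[of ?s "{..<card \<sigma>}" \<sigma>] len st by simp
  have lt: "?s ! i < ?s ! j \<longleftrightarrow> i < j" if "i < card \<sigma>" "j < card \<sigma>" for i j
    using strict_sorted_list_of_set[of \<sigma>] that len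
    by (metis linorder_neqE_nat not_less_iff_gr_or_eq sorted_wrt_nth_less)
  have "below (?s ! j) \<sigma> = j" if j: "j < card \<sigma>" for j
  proof -
    have "{w \<in> \<sigma>. w < ?s ! j} = (\<lambda>j. ?s ! j) ` {..<j}"
    proof (intro equalityI subsetI)
      fix w assume "w \<in> {w \<in> \<sigma>. w < ?s ! j}"
      then obtain i where "i < card \<sigma>" "w = ?s ! i" "w < ?s ! j"
        using st len by (metis (no_types, lifting) in_set_conv_nth mem_Collect_eq)
      thus "w \<in> (\<lambda>j. ?s ! j) ` {..<j}" using lt[of i j] j by auto
    next
      fix w assume "w \<in> (\<lambda>j. ?s ! j) ` {..<j}"
      then obtain i where i: "i < j" "w = ?s ! i" by auto
      hence "w \<in> \<sigma>" using st len j nth_mem[of i ?s] by simp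
      thus "w \<in> {w \<in> \<sigma>. w < ?s ! j}" using i lt[of i j] j by auto
    qed
    moreover have "inj_on (\<lambda>j. ?s ! j) {..<j}"
      using j by (intro inj_on_subset[OF bij_betw_imp_inj_on[OF bij]]) auto
    ultimately show ?thesis by (simp add: below_def card_image)
  qed
  hence "face_boundary \<sigma> =
      (\<Sum>j<card \<sigma>. frag_cmul ((-1) ^ below (?s ! j) \<sigma>) (frag_of (\<sigma> - {?s ! j})))"
    unfolding face_boundary_def by (intro sum.cong) auto
  also have "\<dots> = (\<Sum>v\<in>\<sigma>. frag_cmul ((-1) ^ below v \<sigma>) (frag_of (\<sigma> - {v})))"
    by (rule sum.reindex_bij_betw[OF bij, of "\<lambda>v. frag_cmul ((-1) ^ below v \<sigma>) (frag_of (\<sigma> - {v}))"])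
  finally show ?thesis .
qed

text \<open>Deleting a vertex shifts only the larger ones. This asymmetry is the source of the sign
  change in the double boundary.\<close>

lemma below_diff_singleton:
  assumes "finite \<sigma>" and "v \<in> \<sigma>"
  shows "below w \<sigma> = below w (\<sigma> - {v}) + (if v < w then 1 else 0)"
proof (cases "v < w")
  case True
  hence "{u \<in> \<sigma>. u < w} = insert v {u \<in> \<sigma> - {v}. u < w}" using assms by auto
  thus ?thesis using True assms by (simp add: below_def)
next
  case False
  hence "{u \<in> \<sigma>. u < w} = {u \<in> \<sigma> - {v}. u < w}" by auto
  thus ?thesis using False by (simp add: below_def)
qed

lemma boundary_face_boundary:
  assumes fin: "finite \<sigma>"
  shows "boundary (face_boundary \<sigma>) = 0"
proof -
  \<comment> \<open>The summand for deleting \<open>v\<close> and then \<open>w\<close>. The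
    diagonal is filled with 0 so that both indices range over all of \<open>\<sigma>\<close> and can
    be exchanged.\<close>
  define f where "f = (\<lambda>v w. if v = w then 0 else
    frag_cmul ((-1) ^ below v \<sigma> * (-1) ^ below w (\<sigma> - {v})) (frag_of (\<sigma> - {v} - {w})))"
  have inner: "frag_cmul ((-1) ^ below v \<sigma>) (face_boundary (\<sigma> - {v})) = (\<Sum>w\<in>\<sigma>. f v w)"
    if "v \<in> \<sigma>" for v
  proof -
    have "frag_cmul ((-1) ^ below v \<sigma>) (face_boundary (\<sigma> - {v})) = (\<Sum>w\<in>\<sigma> - {v}. f v w)"
      unfolding face_boundary_below[OF finite_Diff[OF fin]] frag_cmul_sum
      by (rule sum.cong[OF refl]) (auto simp: f_def)
    also have "\<dots> = (\<Sum>w\<in>\<sigma>. f v w)"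
      by (rule sum.mono_neutral_left) (auto simp: f_def fin)
    finally show ?thesis .
  qed
  have "boundary (face_boundary \<sigma>) =
      (\<Sum>v\<in>\<sigma>. frag_cmul ((-1) ^ below v \<sigma>) (face_boundary (\<sigma> - {v})))"
    unfolding face_boundary_below[OF fin] boundary_def
    by (simp add: frag_extend_sum[OF fin] frag_extend_cmul)
  hence S: "boundary (face_boundary \<sigma>) = (\<Sum>v\<in>\<sigma>. \<Sum>w\<in>\<sigma>. f v w)"
    using inner by (simp cong: sum.cong)
  \<comment> \<open>Deleting the smaller vertex first lowers the position of the larger by one;
    deleting the larger first leaves the position of the smaller unchanged. Both orders give the
    same face.\<close>
  have lt: "f w v = - f v w" if vw: "v \<in> \<sigma>" "w \<in> \<sigma>" "v < w" for v w
  proof -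
    have "below w \<sigma> = Suc (below w (\<sigma> - {v}))" using below_diff_singleton[OF fin vw(1), of w] vw by simp
    moreover have "below v \<sigma> = below v (\<sigma> - {w})" using below_diff_singleton[OF fin vw(2), of v] vw by simp
    moreover have "\<sigma> - {w} - {v} = \<sigma> - {v} - {w}" by auto
    ultimately show ?thesis using vw(3) by (simp add: f_def mult.commute)
  qed
  have anti: "f v w = - f w v" if "v \<in> \<sigma>" "w \<in> \<sigma>" for v w
  proof (cases v w rule: linorder_cases)
    case less thus ?thesis using lt[OF that] by simp
  next
    case equal thus ?thesis by (simp add: f_def)
  next
    case greater thus ?thesis using lt[OF that(2,1)] by simp
  qed
  have "(\<Sum>v\<in>\<sigma>. \<Sum>w\<in>\<sigma>. f v w) = (\<Sum>v\<in>\<sigma>. \<Sum>w\<in>\<sigma>. - f w v)"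
    by (intro sum.cong refl anti)
  also have "\<dots> = - (\<Sum>v\<in>\<sigma>. \<Sum>w\<in>\<sigma>. f w v)" by (simp only: sum_negf)
  also have "\<dots> = - (\<Sum>v\<in>\<sigma>. \<Sum>w\<in>\<sigma>. f v w)" by (subst sum.swap) (rule refl)
  finally have "boundary (face_boundary \<sigma>) = - boundary (face_boundary \<sigma>)"
    unfolding S .
  \<comment> \<open>A chain equal to its own negative is 0 because a free abelian group has no
    2-torsion.\<close>
  hence "frag_cmul 2 (boundary (face_boundary \<sigma>)) = 0"
    using frag_cmul_distrib[of 1 1 "boundary (face_boundary \<sigma>)"] by (simp add: eq_neg_iff_add_eq_0)
  thus ?thesis by simp
qed

section \<open>Rank-nullity over the integers and ranks of chain groups\<close>

text \<open>Let \<open>P\<close> consist of preimages under \<open>U\<close> of the basis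
  \<open>G\<close> of the image. Then \<open>P\<close> and the kernel basis \<open>K\<close> side by
  side form a matrix \<open>N\<close> that is bijective on integer vectors, and such a matrix must
  be square.\<close>

lemma rank_nullity:
  assumes G: "basis_mat (dim_row U) G (col_lattice U)"
    and K: "basis_mat (dim_col U) K {c \<in> carrier_vec (dim_col U). U *\<^sub>v c = 0\<^sub>v (dim_row U)}"
  shows "dim_col G + dim_col K = dim_col U"
proof -
  let ?n = "dim_col U" and ?r = "dim_col G" and ?s = "dim_col K"
  have G: "dim_row G = dim_row U" "inj_mat G" "col_lattice G = col_lattice U"
    and K: "dim_row K = ?n" "inj_mat K"
      "col_lattice K = {c \<in> carrier_vec ?n. U *\<^sub>v c = 0\<^sub>v (dim_row U)}"
    using G K by (auto simp: basis_mat_iff)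
  have colG: "col G j \<in> col_lattice U" if "j < dim_col G" for j
    using col_in_col_lattice[OF that] G(3) by simp
  obtain P where P: "P \<in> carrier_mat ?n ?r" "G = U * P"
    using col_lattice_factor[of G U, OF G(1) colG] by metis
  have Kc: "K \<in> carrier_mat ?n ?s" using K(1) by (rule carrier_matI) simp
  define N where "N = mat ?n (?r + ?s) (\<lambda>(i,j). if j < ?r then P $$ (i,j) else K $$ (i,j - ?r))"
  have N: "N \<in> carrier_mat ?n (?r + ?s)" by (simp add: N_def)
  have dN: "dim_row N = ?n" "dim_col N = ?r + ?s" using N by auto
  have Nv: "N *\<^sub>v (u @\<^sub>v w) = P *\<^sub>v u + K *\<^sub>v w" if u: "u \<in> carrier_vec ?r" and w: "w \<in> carrier_vec ?s" for u w
  proof (rule eq_vecI)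
    fix i assume "i < dim_vec (P *\<^sub>v u + K *\<^sub>v w)"
    hence i: "i < ?n" using K(1) by simp
    have "row N i = row P i @\<^sub>v row K i"
      by (rule eq_vecI) (use i carrier_matD[OF P(1)] K(1) in \<open>simp_all add: N_def\<close>)
    moreover have "(row P i @\<^sub>v row K i) \<bullet> (u @\<^sub>v w) = row P i \<bullet> u + row K i \<bullet> w"
      by (rule scalar_prod_append[OF row_carrier_vec[OF i P(1)] row_carrier_vec[OF i Kc] u w])
    ultimately show "(N *\<^sub>v (u @\<^sub>v w)) $ i = (P *\<^sub>v u + K *\<^sub>v w) $ i"
      using i dN K(1) carrier_matD[OF P(1)] by simp
  qed (use dN K(1) in simp)
  have Pu: "P *\<^sub>v u \<in> carrier_vec ?n" "U *\<^sub>v (P *\<^sub>v u) = G *\<^sub>v u" if "u \<in> carrier_vec ?r" for u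
    using mult_mat_vec_carrier[OF P(1) that] assoc_mult_mat_vec[OF carrier_mat_dims P(1) that] P(2) by simp_all
  have Kw: "K *\<^sub>v w \<in> carrier_vec ?n" "U *\<^sub>v (K *\<^sub>v w) = 0\<^sub>v (dim_row U)" if "w \<in> carrier_vec ?s" for w
  proof -
    have "K *\<^sub>v w \<in> col_lattice K" using that by (simp add: col_lattice_def)
    thus "K *\<^sub>v w \<in> carrier_vec ?n" "U *\<^sub>v (K *\<^sub>v w) = 0\<^sub>v (dim_row U)" unfolding K(3) by simp_all
  qed
  have UN: "U *\<^sub>v (P *\<^sub>v u + K *\<^sub>v w) = G *\<^sub>v u" if "u \<in> carrier_vec ?r" "w \<in> carrier_vec ?s" for u w
  proof -
    have "U *\<^sub>v (P *\<^sub>v u + K *\<^sub>v w) = G *\<^sub>v u + 0\<^sub>v (dim_row U)"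
      using mult_add_distrib_mat_vec[OF carrier_mat_dims Pu(1)[OF that(1)] Kw(1)[OF that(2)]]
        Pu(2)[OF that(1)] Kw(2)[OF that(2)] by simp
    moreover have "G *\<^sub>v u \<in> carrier_vec (dim_row U)"
      using mult_mat_vec_carrier[OF carrier_mat_dims that(1)] G(1) by simp
    ultimately show ?thesis by simp
  qed
  have "inj_mat N" unfolding inj_mat_def dN
  proof (intro ballI impI)
    fix z assume z: "z \<in> carrier_vec (?r + ?s)" "N *\<^sub>v z = 0\<^sub>v ?n"
    define u w where "u = vec_first z ?r" and "w = vec_last z ?s"
    have uw: "u \<in> carrier_vec ?r" "w \<in> carrier_vec ?s" "z = u @\<^sub>v w"
      using z(1) by (simp_all add: u_def w_def)
    have sum: "P *\<^sub>v u + K *\<^sub>v w = 0\<^sub>v ?n" using z(2) Nv[OF uw(1,2)] uw(3) by metis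
    have "U *\<^sub>v 0\<^sub>v ?n = 0\<^sub>v (dim_row U)" by auto
    hence "G *\<^sub>v u = 0\<^sub>v (dim_row G)" using UN[OF uw(1,2)] sum G(1) by metis
    hence u0: "u = 0\<^sub>v ?r" using G(2) uw(1) unfolding inj_mat_def by blast
    have "P *\<^sub>v u = 0\<^sub>v ?n" unfolding u0 using P(1) by auto
    hence "K *\<^sub>v w = 0\<^sub>v (dim_row K)" using sum Kw(1)[OF uw(2)] K(1) by simp
    hence "w = 0\<^sub>v ?s" using K(2) uw(2) unfolding inj_mat_def by blast
    thus "z = 0\<^sub>v (?r + ?s)" using uw(3) u0 by auto
  qed
  from inj_mat_dim_le[OF this] have le: "?r + ?s \<le> ?n" by (simp add: dN)
  have surj: "v \<in> col_lattice N" if v: "v \<in> carrier_vec ?n" for v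
  proof -
    have "U *\<^sub>v v \<in> col_lattice G" unfolding G(3) using v by (simp add: col_lattice_def)
    then obtain u where u: "u \<in> carrier_vec ?r" "U *\<^sub>v v = G *\<^sub>v u" by (auto simp: col_lattice_def)
    have "U *\<^sub>v (v - P *\<^sub>v u) = G *\<^sub>v u - G *\<^sub>v u"
      using mult_minus_distrib_mat_vec[OF carrier_mat_dims v Pu(1)[OF u(1)]] Pu(2)[OF u(1)] u(2) by simp
    hence "U *\<^sub>v (v - P *\<^sub>v u) = 0\<^sub>v (dim_row U)" using G(1) by auto
    hence "v - P *\<^sub>v u \<in> col_lattice K" unfolding K(3) using v Pu(1)[OF u(1)] by simp
    then obtain w where w: "w \<in> carrier_vec ?s" "v - P *\<^sub>v u = K *\<^sub>v w" by (auto simp: col_lattice_def)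
    have "v = P *\<^sub>v u + K *\<^sub>v w" unfolding w(2)[symmetric]
      by (rule eq_vecI) (use v carrier_matD[OF P(1)] in simp_all)
    hence "v = N *\<^sub>v (u @\<^sub>v w)" using Nv[OF u(1) w(1)] by simp
    moreover have "u @\<^sub>v w \<in> carrier_vec (dim_col N)" using u(1) w(1) dN by simp
    ultimately show ?thesis unfolding col_lattice_def by blast
  qed
  \<comment> \<open>Surjectivity at the unit vectors yields a right inverse \<open>W\<close> of
    \<open>N\<close>. Since \<open>N * W\<close> is the identity, \<open>W\<close> is injective, and
    counting its columns against its rows gives the missing inequality.\<close>
  have cols: "col (1\<^sub>m ?n) j \<in> col_lattice N" if "j < dim_col (1\<^sub>m ?n :: int mat)" for j
    by (rule surj) (use that in simp)
  have "dim_row (1\<^sub>m ?n :: int mat) = dim_row N" by (simp add: dN)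
  then obtain W where W': "W \<in> carrier_mat (dim_col N) (dim_col (1\<^sub>m ?n :: int mat))" "1\<^sub>m ?n = N * W"
    by (rule col_lattice_factor[OF _ cols])
  have W: "W \<in> carrier_mat (dim_col N) ?n" using W'(1) unfolding index_one_mat(3) .
  have "inj_mat (1\<^sub>m ?n)" unfolding inj_mat_def by simp
  hence "inj_mat W" unfolding W'(2) by (rule inj_mat_multD[OF _ W])
  from inj_mat_dim_le[OF this] have "?n \<le> ?r + ?s" using carrier_matD[OF W] dN by simp
  thus ?thesis using le by simp
qed

lemma module_frag_cmul: "Modules.module frag_cmul"
  by unfold_locales (simp_all add: frag_cmul_distrib frag_cmul_distrib2)

lemma chain_of_eq_0D:
  assumes "distinct xs" and "w \<in> carrier_vec (length xs)" and "chain_of xs w = 0"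
  shows "w = 0\<^sub>v (length xs)"
  by (rule inj_onD[OF bij_betw_imp_inj_on[OF bij_betw_chain_of[OF assms(1)]]])
    (use assms in \<open>simp_all add: chain_of_zero\<close>)

lemma chain_of_mult:
  assumes V: "dim_row V = length xs" and c: "c \<in> carrier_vec (dim_col V)"
  shows "(\<Sum>j<dim_col V. frag_cmul (c $ j) (chain_of xs (col V j))) = chain_of xs (V *\<^sub>v c)"
proof (rule poly_mapping_eqI)
  fix x
  have "Poly_Mapping.lookup (\<Sum>j<dim_col V. frag_cmul (c $ j) (chain_of xs (col V j))) x =
      (\<Sum>j<dim_col V. \<Sum>i<length xs. if xs ! i = x then c $ j * V $$ (i,j) else 0)"
    unfolding lookup_sum_frag lookup_frag_cmul lookup_chain_of sum_distrib_left
    by (intro sum.cong refl) (simp add: V)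
  also have "\<dots> = (\<Sum>i<length xs. \<Sum>j<dim_col V. if xs ! i = x then c $ j * V $$ (i,j) else 0)"
    by (rule sum.swap)
  also have "\<dots> = (\<Sum>i<length xs. if xs ! i = x then (V *\<^sub>v c) $ i else 0)"
    by (intro sum.cong refl) (use c V in \<open>simp add: scalar_prod_def atLeast0LessThan mult.commute\<close>)
  finally show "Poly_Mapping.lookup (\<Sum>j<dim_col V. frag_cmul (c $ j) (chain_of xs (col V j))) x =
      Poly_Mapping.lookup (chain_of xs (V *\<^sub>v c)) x" unfolding lookup_chain_of .
qed

text \<open>One half of the dictionary between trivial kernels and independence in the module of
  chains. Independence there concerns sets, so injectivity of the column map is stated
  separately.\<close>

lemma independent_chain_of_cols:
  assumes xs: "distinct xs" and V: "dim_row V = length xs" and inj: "inj_mat V"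
  shows "inj_on (\<lambda>j. chain_of xs (col V j)) {..<dim_col V}"
    and "\<not> Modules.module.dependent frag_cmul ((\<lambda>j. chain_of xs (col V j)) ` {..<dim_col V})"
proof -
  let ?b = "\<lambda>j. chain_of xs (col V j)" and ?k = "dim_col V"
  show b: "inj_on ?b {..<?k}"
  proof (rule inj_onI)
    fix i j assume ij: "i \<in> {..<?k}" "j \<in> {..<?k}" "?b i = ?b j"
    have "col V i = col V j"
      by (rule inj_onD[OF bij_betw_imp_inj_on[OF bij_betw_chain_of[OF xs]]])
        (use ij V in \<open>auto simp: carrier_vecI\<close>)
    hence "V *\<^sub>v unit_vec ?k i = V *\<^sub>v unit_vec ?k j"
      using ij mult_unit_vec_col[OF carrier_mat_dims] by simp
    hence "(unit_vec ?k i :: int vec) = unit_vec ?k j"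
      by (rule inj_onD[OF inj_mat_inj_on[OF inj]]) auto
    hence "(unit_vec ?k i :: int vec) $ i = unit_vec ?k j $ i" by simp
    thus "i = j" using ij by (simp split: if_splits)
  qed
  show "\<not> Modules.module.dependent frag_cmul (?b ` {..<?k})"
  proof
    assume "Modules.module.dependent frag_cmul (?b ` {..<?k})"
    then obtain u where u: "\<exists>v\<in>?b ` {..<?k}. u v \<noteq> 0" "(\<Sum>v\<in>?b ` {..<?k}. frag_cmul (u v) v) = 0"
      by (subst (asm) Modules.module.dependent_finite[OF module_frag_cmul]) auto
    let ?c = "vec ?k (\<lambda>j. u (?b j))"
    have "(\<Sum>j<?k. frag_cmul (?c $ j) (?b j)) = (\<Sum>j<?k. frag_cmul (u (?b j)) (?b j))"
      by (intro sum.cong) auto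
    also have "\<dots> = 0" using u(2) by (simp add: sum.reindex[OF b])
    finally have "chain_of xs (V *\<^sub>v ?c) = 0" using chain_of_mult[OF V, of ?c] by simp
    hence "V *\<^sub>v ?c = 0\<^sub>v (dim_row V)"
      using chain_of_eq_0D[OF xs, of "V *\<^sub>v ?c"] V by (simp add: carrier_vecI)
    hence c0: "?c = 0\<^sub>v ?k" using inj unfolding inj_mat_def by simp
    obtain j where j: "j < ?k" "u (?b j) \<noteq> 0" using u(1) by auto
    have "?c $ j = 0" unfolding c0 using j by simp
    thus False using j by simp
  qed
qed

lemma inj_mat_of_independent:
  assumes V: "dim_row V = length xs"
    and b: "inj_on (\<lambda>j. chain_of xs (col V j)) {..<dim_col V}"
    and ind: "\<not> Modules.module.dependent frag_cmul ((\<lambda>j. chain_of xs (col V j)) ` {..<dim_col V})"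
  shows "inj_mat V"
  unfolding inj_mat_def
proof (intro ballI impI)
  let ?b = "\<lambda>j. chain_of xs (col V j)" and ?k = "dim_col V"
  fix c assume c: "c \<in> carrier_vec ?k" "V *\<^sub>v c = 0\<^sub>v (dim_row V)"
  \<comment> \<open>Coefficients indexed by columns are transferred to coefficients indexed by
    chains along the inverse of the injective column map.\<close>
  define u where "u = (\<lambda>v. c $ (the_inv_into {..<?k} ?b v))"
  have ub: "u (?b j) = c $ j" if "j < ?k" for j
    using the_inv_into_f_f[OF b] that by (simp add: u_def)
  have "(\<Sum>v\<in>?b ` {..<?k}. frag_cmul (u v) v) = (\<Sum>j<?k. frag_cmul (c $ j) (?b j))"
    unfolding sum.reindex[OF b] by (rule sum.cong) (simp_all add: ub)
  also have "\<dots> = 0" using chain_of_mult[OF V c(1)] c(2) V by (simp add: chain_of_zero)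
  finally have "\<forall>v\<in>?b ` {..<?k}. u v = 0"
    using ind Modules.module.dependent_finite[OF module_frag_cmul, of "?b ` {..<?k}"] by blast
  thus "c = 0\<^sub>v ?k" using ub c(1) by (intro eq_vecI) auto
qed

text \<open>The columns of \<open>F\<close> attain the maximum. An independent set in the image of
  \<open>A\<close> gives an injective \<open>V = F * H\<close>, so \<open>H\<close> is injective and
  its columns do not outnumber those of \<open>F\<close>. The bound also makes the set under
  \<open>Max\<close> finite.\<close>

lemma chain_rank_chain_of:
  assumes xs: "distinct xs" and F: "basis_mat (length xs) F A"
  shows "chain_rank (chain_of xs ` A) = dim_col F"
proof -
  have F: "dim_row F = length xs" "inj_mat F" "col_lattice F = A" using F by (auto simp: basis_mat_iff)
  let ?P = "\<lambda>S. S \<subseteq> chain_of xs ` A \<and> finite S \<and> \<not> Modules.module.dependent frag_cmul S"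
  have le: "card S \<le> dim_col F" if S: "?P S" for S
  proof -
    obtain ss where ss: "set ss = S" "distinct ss" using finite_distinct_list S by blast
    have "\<exists>w\<in>A. ss ! j = chain_of xs w" if "j < length ss" for j
      using S ss(1) nth_mem[OF that] by blast
    then obtain w where w: "\<And>j. j < length ss \<Longrightarrow> w j \<in> A \<and> ss ! j = chain_of xs (w j)" by metis
    have wc: "w j \<in> carrier_vec (length xs)" if "j < length ss" for j
      using w[OF that] int_subgroup_carrier[OF int_subgroup_col_lattice[of F]] F by simp
    define V where "V = mat_of_cols (length xs) (map w [0..<length ss])"
    have V: "dim_row V = length xs" "dim_col V = length ss" by (simp_all add: V_def)
    have colV: "col V j = w j" if "j < length ss" for j
      unfolding V_def using that wc by (subst col_mat_of_cols) auto
    have b: "chain_of xs (col V j) = ss ! j" if "j < length ss" for j using w colV that by simp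
    have "inj_on (\<lambda>j. chain_of xs (col V j)) {..<dim_col V}"
      using b ss(2) V(2) by (auto simp: inj_on_def nth_eq_iff_index_eq)
    moreover have "(\<lambda>j. chain_of xs (col V j)) ` {..<dim_col V} = S"
      using b V(2) ss(1) by (auto simp: in_set_conv_nth image_iff)
    ultimately have inj: "inj_mat V" using S V(1) by (intro inj_mat_of_independent[of V xs]) simp_all
    have "col V j \<in> col_lattice F" if "j < dim_col V" for j
      using that w colV V F(3) by simp
    from col_lattice_factor[of V F, OF _ this] V(1) F(1)
    obtain H where H: "H \<in> carrier_mat (dim_col F) (dim_col V)" "V = F * H" by metis
    have "inj_mat H" using inj_mat_multD[OF _ H(1)] inj H(2) by simp
    from inj_mat_dim_le[OF this] have "length ss \<le> dim_col F" using carrier_matD[OF H(1)] V(2) by simp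
    thus ?thesis using distinct_card[OF ss(2)] ss(1) by simp
  qed
  let ?S = "(\<lambda>j. chain_of xs (col F j)) ` {..<dim_col F}"
  note ind = independent_chain_of_cols[OF xs F(1,2)]
  have "?P ?S" using ind(2) col_in_col_lattice[of _ F] F(3) by auto
  moreover have "card ?S = dim_col F" using card_image[OF ind(1)] by simp
  ultimately have mem: "dim_col F \<in> {card S |S. ?P S}" by (metis (mono_tags, lifting) mem_Collect_eq)
  show ?thesis unfolding chain_rank_def
  proof (rule Max_eqI[OF _ _ mem])
    have "{card S |S. ?P S} \<subseteq> {..dim_col F}" using le by auto
    thus "finite {card S |S. ?P S}" by (rule finite_subset) simp
  qed (use le in auto)
qed

section \<open>Quotients of chain groups\<close>

text \<open>Two cosets coincide exactly when the difference of their representatives lies in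
  \<open>N\<close>, so \<open>R\<close> meets each coset in \<open>A\<close> exactly once.\<close>

lemma card_cosets:
  fixes A :: "'a::ab_group_add set"
  assumes N: "0 \<in> N" "\<And>u v. u \<in> N \<Longrightarrow> v \<in> N \<Longrightarrow> u - v \<in> N" and R: "transversal N A R"
  shows "card ((\<lambda>a. (\<lambda>n. n + a) ` N) ` A) = card R"
proof -
  let ?c = "\<lambda>a. (\<lambda>n. n + a) ` N"
  have RA: "R \<subseteq> A" and ex: "\<And>v. v \<in> A \<Longrightarrow> \<exists>!\<rho>. \<rho> \<in> R \<and> v - \<rho> \<in> N"
    using R by (auto simp: transversal_def)
  have mem: "x \<in> ?c a \<longleftrightarrow> x - a \<in> N" for x a
    by (auto simp: image_iff) (metis diff_add_cancel)
  have eqI: "?c a = ?c b" if ab: "a - b \<in> N" for a b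
  proof -
    have "x - a \<in> N \<longleftrightarrow> x - b \<in> N" for x
    proof
      assume "x - a \<in> N"
      moreover have "0 - (a - b) \<in> N" using N ab by blast
      ultimately have "(x - a) - (0 - (a - b)) \<in> N" by (rule N(2))
      thus "x - b \<in> N" by simp
    next
      assume "x - b \<in> N"
      from N(2)[OF this ab] show "x - a \<in> N" by (simp add: algebra_simps)
    qed
    thus ?thesis using mem by blast
  qed
  have eqD: "a - b \<in> N" if "?c a = ?c b" for a b
  proof -
    have "a \<in> ?c a" using mem[of a a] N(1) by simp
    thus ?thesis using that mem[of a b] by simp
  qed
  have "?c ` A = ?c ` R"
  proof (intro equalityI subsetI)
    fix S assume "S \<in> ?c ` A"
    then obtain a where a: "a \<in> A" "S = ?c a" by blast
    obtain \<rho> where "\<rho> \<in> R" "a - \<rho> \<in> N" using ex[OF a(1)] by blast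
    thus "S \<in> ?c ` R" using eqI[of a \<rho>] a(2) by (intro image_eqI[of _ _ \<rho>]) simp_all
  qed (use RA in blast)
  moreover have "inj_on ?c R"
  proof (rule inj_onI)
    fix a b assume ab: "a \<in> R" "b \<in> R" "?c a = ?c b"
    have "a - b \<in> N" "a - a \<in> N" using eqD[OF ab(3)] N(1) by simp_all
    moreover have "a \<in> A" using ab RA by blast
    ultimately show "a = b" using ex[of a] ab by blast
  qed
  ultimately show ?thesis by (simp add: card_image)
qed

text \<open>Subgroups of a free abelian group described additively, so that closure is checked on
  plain chains before passing to the multiplicative group structure.\<close>

definition frag_subgroup :: "'a set \<Rightarrow> ('a \<Rightarrow>\<^sub>0 int) set \<Rightarrow> bool" where
  "frag_subgroup S A \<longleftrightarrow>
     (\<forall>c\<in>A. Poly_Mapping.keys c \<subseteq> S) \<and> 0 \<in> A \<and> (\<forall>u\<in>A. \<forall>v\<in>A. u - v \<in> A)"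

lemma frag_subgroupD:
  assumes "frag_subgroup S A"
  shows "subgroup A (free_Abelian_group S)"
proof -
  have keys: "Poly_Mapping.keys c \<subseteq> S" if "c \<in> A" for c using assms that by (auto simp: frag_subgroup_def)
  have zero: "0 \<in> A" and minus: "\<And>u v. u \<in> A \<Longrightarrow> v \<in> A \<Longrightarrow> u - v \<in> A"
    using assms by (auto simp: frag_subgroup_def)
  have um: "- u \<in> A" if "u \<in> A" for u using minus[OF zero that] by simp
  show ?thesis
  proof
    show "A \<subseteq> carrier (free_Abelian_group S)" using keys by auto
    fix x y assume "x \<in> A" "y \<in> A"
    from minus[OF this(1) um[OF this(2)]]
    show "x \<otimes>\<^bsub>free_Abelian_group S\<^esub> y \<in> A" by simp
  next
    fix x assume "x \<in> A"
    thus "inv\<^bsub>free_Abelian_group S\<^esub> x \<in> A" using um keys by simp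
  qed (simp add: zero)
qed

context
  fixes S :: "'a set" and A N :: "('a \<Rightarrow>\<^sub>0 int) set"
  assumes A: "frag_subgroup S A" and N: "frag_subgroup S N" and NA: "N \<subseteq> A"
begin

lemma carrier_frag_subgroup: "carrier (subgroup_generated (free_Abelian_group S) A) = A"
  using subgroup.carrier_subgroup_generated_subgroup[OF frag_subgroupD[OF A]] .

lemma r_coset_frag: "N #>\<^bsub>subgroup_generated (free_Abelian_group S) A\<^esub> a = (\<lambda>n. n + a) ` N"
  by (auto simp: r_coset_def)

lemma carrier_frag_quotient:
  "carrier (subgroup_generated (free_Abelian_group S) A Mod N) = (\<lambda>a. (\<lambda>n. n + a) ` N) ` A"
  by (simp add: carrier_FactGroup carrier_frag_subgroup r_coset_frag)

lemma normal_frag: "N \<lhd> subgroup_generated (free_Abelian_group S) A"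
proof -
  interpret C: comm_group "free_Abelian_group S" by (rule abelian_free_Abelian_group)
  have "comm_group (subgroup_generated (free_Abelian_group S) A)"
    by (rule C.abelian_subgroup_generated[OF C.comm_group_axioms])
  moreover have "subgroup N (subgroup_generated (free_Abelian_group S) A)"
    by (rule C.subgroup_of_subgroup_generated[OF NA frag_subgroupD[OF N]])
  ultimately show ?thesis by (rule comm_group.subgroup_imp_normal)
qed

lemma order_frag_quotient:
  assumes "transversal N A R"
  shows "Coset.order (subgroup_generated (free_Abelian_group S) A Mod N) = card R"
  unfolding Coset.order_def carrier_frag_quotient
  by (rule card_cosets[OF _ _ assms]) (use N in \<open>auto simp: frag_subgroup_def\<close>)

text \<open>The \<open>m\<close>-th power of the class of \<open>a\<close> is the class of
  \<open>m\<close> times \<open>a\<close>, and a class is neutral exactly when its representative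
  lies in \<open>N\<close>.\<close>

lemma torsion_frag_quotient:
  "torsion (subgroup_generated (free_Abelian_group S) A Mod N) =
    (\<lambda>a. (\<lambda>n. n + a) ` N) ` {a \<in> A. \<exists>m::nat. 0 < m \<and> frag_cmul (int m) a \<in> N}"
proof -
  let ?G = "subgroup_generated (free_Abelian_group S) A"
  have zero: "0 \<in> N" and minus: "\<And>u v. u \<in> N \<Longrightarrow> v \<in> N \<Longrightarrow> u - v \<in> N"
    using N by (auto simp: frag_subgroup_def)
  have one: "(\<lambda>n. n + b) ` N = N \<longleftrightarrow> b \<in> N" for b
  proof
    assume e: "(\<lambda>n. n + b) ` N = N"
    have "0 + b \<in> (\<lambda>n. n + b) ` N" using zero by (rule imageI)
    thus "b \<in> N" unfolding e by simp
  next
    assume b: "b \<in> N"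
    have "x \<in> (\<lambda>n. n + b) ` N" if "x \<in> N" for x
      by (rule image_eqI[OF _ minus[OF that b]]) simp
    moreover have "x + b \<in> N" if "x \<in> N" for x
      using minus[OF that minus[OF zero b]] by simp
    ultimately show "(\<lambda>n. n + b) ` N = N" by blast
  qed
  have pow: "((\<lambda>n. n + a) ` N) [^]\<^bsub>?G Mod N\<^esub> m = (\<lambda>n. n + frag_cmul (int m) a) ` N" if "a \<in> A" for a and m :: nat
  proof -
    have "(N #>\<^bsub>?G\<^esub> a) [^]\<^bsub>?G Mod N\<^esub> m = N #>\<^bsub>?G\<^esub> (a [^]\<^bsub>?G\<^esub> m)"
      by (rule normal.FactGroup_pow[OF normal_frag]) (simp add: carrier_frag_subgroup that)
    thus ?thesis by (simp add: r_coset_frag pow_subgroup_generated)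
  qed
  show ?thesis
  proof (intro equalityI subsetI)
    fix g assume "g \<in> torsion (?G Mod N)"
    then obtain a m where a: "a \<in> A" "g = (\<lambda>n. n + a) ` N" and m: "0 < m" "g [^]\<^bsub>?G Mod N\<^esub> (m::nat) = N"
      by (auto simp: torsion_def carrier_frag_quotient)
    have "frag_cmul (int m) a \<in> N" using m(2) unfolding a(2) pow[OF a(1)] one .
    thus "g \<in> (\<lambda>a. (\<lambda>n. n + a) ` N) ` {a \<in> A. \<exists>m::nat. 0 < m \<and> frag_cmul (int m) a \<in> N}"
      using a m(1) by blast
  next
    fix g assume "g \<in> (\<lambda>a. (\<lambda>n. n + a) ` N) ` {a \<in> A. \<exists>m::nat. 0 < m \<and> frag_cmul (int m) a \<in> N}"
    then obtain a m where a: "a \<in> A" "g = (\<lambda>n. n + a) ` N" and m: "0 < m" "frag_cmul (int (m::nat)) a \<in> N"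
      by blast
    have "g [^]\<^bsub>?G Mod N\<^esub> m = N" unfolding a(2) pow[OF a(1)] one by (rule m(2))
    thus "g \<in> torsion (?G Mod N)"
      using a m(1) unfolding torsion_def carrier_frag_quotient one_FactGroup by blast
  qed
qed

end

lemma frag_subgroup_chain_of:
  assumes "int_subgroup (length xs) L"
  shows "frag_subgroup (set xs) (chain_of xs ` L)"
  unfolding frag_subgroup_def
proof (intro conjI ballI)
  fix c assume "c \<in> chain_of xs ` L"
  thus "Poly_Mapping.keys c \<subseteq> set xs" using keys_chain_of by (metis imageE)
next
  show "0 \<in> chain_of xs ` L"
    by (rule image_eqI[of _ _ "0\<^sub>v (length xs)"])
      (simp_all add: chain_of_zero int_subgroup_zero[OF assms])
next
  fix u v assume "u \<in> chain_of xs ` L" "v \<in> chain_of xs ` L"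
  then obtain a b where ab: "a \<in> L" "b \<in> L" "u = chain_of xs a" "v = chain_of xs b" by blast
  have "u - v = chain_of xs (a - b)"
    using chain_of_minus ab int_subgroup_carrier[OF assms] by metis
  thus "u - v \<in> chain_of xs ` L" using int_subgroup_minus[OF assms ab(1,2)] by blast
qed

lemma transversal_chain_of:
  assumes xs: "distinct xs" and L: "int_subgroup (length xs) L" "int_subgroup (length xs) M"
    and R: "transversal L M R"
  shows "transversal (chain_of xs ` L) (chain_of xs ` M) (chain_of xs ` R)" 
    and "card (chain_of xs ` R) = card R"
proof -
  have LM: "L \<subseteq> carrier_vec (length xs)" "M \<subseteq> carrier_vec (length xs)"
    using L by (auto simp: int_subgroup_def)
  have "u - v \<in> carrier_vec (length xs) \<and> chain_of xs u - chain_of xs v = chain_of xs (u - v)"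
    if "u \<in> M" "v \<in> M" for u v
    using chain_of_minus[of u xs v] that[THEN int_subgroup_carrier[OF L(2)]] by simp
  from transversal_image[OF R bij_betw_imp_inj_on[OF bij_betw_chain_of[OF xs]] LM this]
  show "transversal (chain_of xs ` L) (chain_of xs ` M) (chain_of xs ` R)" 
    and "card (chain_of xs ` R) = card R" by blast+
qed

lemma boundary_boundary:
  assumes "\<And>\<sigma>. \<sigma> \<in> Poly_Mapping.keys c \<Longrightarrow> finite \<sigma>"
  shows "boundary (boundary c) = 0"
proof -
  have "boundary (boundary c) =
      (\<Sum>\<sigma>\<in>Poly_Mapping.keys c. frag_cmul (Poly_Mapping.lookup c \<sigma>) (boundary (face_boundary \<sigma>)))"
    unfolding boundary_def[THEN fun_cong, of c] frag_extend_def[of face_boundary c]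
    unfolding boundary_def by (simp add: frag_extend_sum frag_extend_cmul)
  also have "\<dots> = 0" using assms by (intro sum.neutral) (simp add: boundary_face_boundary)
  finally show ?thesis .
qed

text \<open>The empty face fits in: it has no vertex to delete, so its boundary is 0.\<close>

lemma keys_face_boundary:
  assumes "abstract_complex K" and "f \<in> faces d K"
  shows "Poly_Mapping.keys (face_boundary f) \<subseteq> faces (d - 1) K"
proof -
  have f: "f \<in> K" "finite f" "face_dim f = d" and sub: "\<And>\<tau>. \<tau> \<subseteq> f \<Longrightarrow> \<tau> \<in> K"
    using assms by (auto simp: abstract_complex_def faces_def)
  have "Poly_Mapping.keys (face_boundary f) \<subseteq> (\<Union>v\<in>f. Poly_Mapping.keys (frag_cmul ((-1) ^ below v f) (frag_of (f - {v}))))"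
    unfolding face_boundary_below[OF f(2)] by (rule keys_sum)
  also have "\<dots> \<subseteq> (\<Union>v\<in>f. {f - {v}})" by (intro UN_mono order_refl order_trans[OF keys_cmul]) simp
  also have "\<dots> \<subseteq> faces (d - 1) K"
  proof
    fix \<tau> assume "\<tau> \<in> (\<Union>v\<in>f. {f - {v}})"
    then obtain v where v: "v \<in> f" "\<tau> = f - {v}" by blast
    have "card f = Suc (card \<tau>)" unfolding v(2) using card_Suc_Diff1[OF f(2) v(1)] by simp
    hence "face_dim \<tau> = d - 1" using f(3) by (simp add: face_dim_def)
    thus "\<tau> \<in> faces (d - 1) K" using sub[of \<tau>] v(2) by (auto simp: faces_def)
  qed
  finally show ?thesis .
qed

lemma dim_incidence_mat [simp]:
  "dim_row (incidence_mat rs fs) = length rs" "dim_col (incidence_mat rs fs) = length fs"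
  by (simp_all add: incidence_mat_def)

lemma carrier_chain_group: "carrier (chain_group l K) = {c. Poly_Mapping.keys c \<subseteq> faces l K}"
  by (auto simp: chain_group_def free_Abelian_group_def)

lemma boundary_carrier_eq:
  assumes rs: "distinct rs" and fs: "enumerates fs (faces d L)"
    and keys: "\<And>f. f \<in> set fs \<Longrightarrow> Poly_Mapping.keys (face_boundary f) \<subseteq> set rs"
  shows "boundary ` carrier (chain_group d L) = chain_of rs ` col_lattice (incidence_mat rs fs)"
proof -
  have fs: "distinct fs" "set fs = faces d L" using fs by (auto simp: enumerates_def)
  have "carrier (chain_group d L) = chain_of fs ` carrier_vec (length fs)"
    using bij_betw_imp_surj_on[OF bij_betw_chain_of[OF fs(1)]] fs(2) by (simp add: carrier_chain_group)
  hence "boundary ` carrier (chain_group d L) = (\<lambda>v. boundary (chain_of fs v)) ` carrier_vec (length fs)"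
    by (simp add: image_image)
  also have "\<dots> = (\<lambda>v. chain_of rs (incidence_mat rs fs *\<^sub>v v)) ` carrier_vec (length fs)"
    by (intro image_cong refl boundary_chain_of rs keys)
  finally show ?thesis by (simp add: col_lattice_def image_image)
qed

lemma cycles_eq:
  assumes rs: "distinct rs" and fs: "enumerates fs (faces d L)"
    and keys: "\<And>f. f \<in> set fs \<Longrightarrow> Poly_Mapping.keys (face_boundary f) \<subseteq> set rs"
  shows "cycles d L =
    chain_of fs ` {v \<in> carrier_vec (length fs). incidence_mat rs fs *\<^sub>v v = 0\<^sub>v (length rs)}"
proof -
  have fs: "distinct fs" "set fs = faces d L" using fs by (auto simp: enumerates_def)
  have C: "carrier (chain_group d L) = chain_of fs ` carrier_vec (length fs)"
    using bij_betw_imp_surj_on[OF bij_betw_chain_of[OF fs(1)]] fs(2) by (simp add: carrier_chain_group)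
  have iff: "boundary (chain_of fs v) = 0 \<longleftrightarrow> incidence_mat rs fs *\<^sub>v v = 0\<^sub>v (length rs)"
    if v: "v \<in> carrier_vec (length fs)" for v
  proof -
    have "incidence_mat rs fs *\<^sub>v v \<in> carrier_vec (length rs)" by (rule carrier_vecI) simp
    moreover have "boundary (chain_of fs v) = chain_of rs (incidence_mat rs fs *\<^sub>v v)"
      by (intro boundary_chain_of rs keys v)
    ultimately show ?thesis using chain_of_eq_0D[OF rs] chain_of_zero[of rs] by metis
  qed
  have "cycles d L = {c \<in> chain_of fs ` carrier_vec (length fs). boundary c = 0}"
    unfolding cycles_def kernel_def C by (simp add: chain_group_def)
  also have "\<dots> = chain_of fs ` {v \<in> carrier_vec (length fs). boundary (chain_of fs v) = 0}"
    by blast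
  also have "{v \<in> carrier_vec (length fs). boundary (chain_of fs v) = 0} =
      {v \<in> carrier_vec (length fs). incidence_mat rs fs *\<^sub>v v = 0\<^sub>v (length rs)}"
    using iff by (intro Collect_cong conj_cong refl)
  finally show ?thesis .
qed

section \<open>Forests\<close>

text \<open>Facets are listed in increasing order of index through \<open>pick\<close>, which is how
  \<open>submatrix\<close> orders its columns.\<close>

definition col_list :: "'a list \<Rightarrow> nat set \<Rightarrow> 'a list" where
  "col_list fs I = map (\<lambda>j. fs ! pick I j) [0..<card I]"

lemma bij_betw_pick:
  assumes "finite I"
  shows "bij_betw (pick I) {..<card I} I"
proof (rule bij_betw_imageI)
  show inj: "inj_on (pick I) {..<card I}"
  proof (rule inj_onI)
    fix i j assume "i \<in> {..<card I}" "j \<in> {..<card I}" "pick I i = pick I j"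
    thus "i = j" using pick_mono_le[of i I j] pick_mono_le[of j I i]
      by (metis lessThan_iff less_irrefl linorder_neqE_nat)
  qed
  have "pick I ` {..<card I} \<subseteq> I" using pick_in_set_le by auto
  moreover have "card (pick I ` {..<card I}) = card I" using card_image[OF inj] by simp
  ultimately show "pick I ` {..<card I} = I" using card_subset_eq[OF assms] by blast
qed

lemma enumerates_col_list:
  assumes fs: "distinct fs" and I: "I \<subseteq> {..<length fs}"
  shows "enumerates (col_list fs I) ((\<lambda>i. fs ! i) ` I)"
proof -
  have "finite I" using I by (rule finite_subset) simp
  note bij = bij_betw_pick[OF this]
  have "inj_on (\<lambda>i. fs ! i) I" using I by (intro inj_on_nth fs) auto
  hence "inj_on (\<lambda>j. fs ! pick I j) {..<card I}"
    using bij by (intro comp_inj_on[of "pick I" _ "\<lambda>i. fs ! i", unfolded o_def]) (auto simp: bij_betw_def)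
  moreover have "(\<lambda>j. fs ! pick I j) ` {..<card I} = (\<lambda>i. fs ! i) ` I"
    using bij_betw_imp_surj_on[OF bij] by (metis image_image)
  ultimately show ?thesis
    by (simp add: enumerates_def col_list_def distinct_map atLeast0LessThan)
qed

lemma length_col_list [simp]: "length (col_list fs I) = card I"
  by (simp add: col_list_def)

lemma submatrix_incidence_mat:
  assumes I: "I \<subseteq> {..<length fs}"
  shows "submatrix (incidence_mat rs fs) UNIV I = incidence_mat rs (col_list fs I)"
proof -
  have c: "{j. j < length fs \<and> j \<in> I} = I" using I by auto
  have "pick I j < length fs" if "j < card I" for j
    using pick_in_set_le[OF that] I by auto
  thus ?thesis
    by (intro eq_matI) (simp_all add: submatrix_def c incidence_mat_def pick_UNIV col_list_def)
qed

lemma incidence_mat_zero: "incidence_mat rs fs *\<^sub>v 0\<^sub>v (length fs) = 0\<^sub>v (length rs)"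
  by (rule eq_vecI) (simp_all add: scalar_prod_def)

section \<open>Boundary lattices and homology of a fixed complex\<close>

context
  fixes K :: "'v::linorder set set" and d :: int and rs fs :: "'v set list"
  assumes K: "abstract_complex K" and dim: "complex_dim K = d"
    and rs: "enumerates rs (faces (d - 1) K)" and fs: "enumerates fs (faces d K)"
begin

lemma distinct_rs: "distinct rs" and set_rs: "set rs = faces (d - 1) K"
  and distinct_fs: "distinct fs" and set_fs: "set fs = faces d K"
  using rs fs by (auto simp: enumerates_def)

lemma finite_face: "\<sigma> \<in> K \<Longrightarrow> finite \<sigma>"
  using K by (auto simp: abstract_complex_def)

lemma face_dim_le: "\<sigma> \<in> K \<Longrightarrow> face_dim \<sigma> \<le> d"
  using K unfolding dim[symmetric] complex_dim_def abstract_complex_def by (intro Max_ge) auto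

lemma keys_ridges: "f \<in> faces d K \<Longrightarrow> Poly_Mapping.keys (face_boundary f) \<subseteq> set rs"
  using keys_face_boundary[OF K] set_rs by blast

text \<open>The rows are the ridges of \<open>K\<close> for every \<open>L\<close>, so all boundary
  lattices lie in the same Z^p and can be compared.\<close>

lemma boundaries_enum:
  assumes gs: "enumerates gs (faces d L)" and L: "faces d L \<subseteq> faces d K"
  shows "boundaries (d - 1) L = chain_of rs ` col_lattice (incidence_mat rs gs)"
    and "boundary_rank d L = chain_rank (chain_of rs ` col_lattice (incidence_mat rs gs))"
    and "cycles d L = chain_of gs ` {v \<in> carrier_vec (length gs). incidence_mat rs gs *\<^sub>v v = 0\<^sub>v (length rs)}"
proof -
  have keys: "Poly_Mapping.keys (face_boundary f) \<subseteq> set rs" if "f \<in> set gs" for f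
    using that gs L by (intro keys_ridges) (auto simp: enumerates_def)
  note bd = boundary_carrier_eq[OF distinct_rs gs keys]
  show "boundaries (d - 1) L = chain_of rs ` col_lattice (incidence_mat rs gs)"
    unfolding boundaries_def using bd by simp
  show "boundary_rank d L = chain_rank (chain_of rs ` col_lattice (incidence_mat rs gs))"
    unfolding boundary_rank_def using bd by simp
  show "cycles d L = chain_of gs ` {v \<in> carrier_vec (length gs). incidence_mat rs gs *\<^sub>v v = 0\<^sub>v (length rs)}"
    by (rule cycles_eq[OF distinct_rs gs keys])
qed

lemma frag_subgroup_lattice:
  assumes "dim_row V = length rs"
  shows "frag_subgroup (faces (d - 1) K) (chain_of rs ` col_lattice V)"
  using frag_subgroup_chain_of[of rs "col_lattice V"] int_subgroup_col_lattice[of V] assms set_rs by simp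

lemma order_boundaries_quotient:
  assumes G: "basis_mat (length rs) G (col_lattice (incidence_mat rs fs))"
    and gs: "enumerates gs (faces d L)" and L: "faces d L \<subseteq> faces d K"
    and N: "N \<in> carrier_mat (dim_col G) (dim_col G)" "incidence_mat rs gs = G * N" "det N \<noteq> 0"
  shows "int (Coset.order (boundaries_quotient (d - 1) K L)) = \<bar>det N\<bar>"
proof -
  have G: "dim_row G = length rs" "inj_mat G" "col_lattice G = col_lattice (incidence_mat rs fs)"
    using G by (auto simp: basis_mat_iff)
  obtain R where R: "int (card R) = \<bar>det N\<bar>" "transversal (col_lattice (G * N)) (col_lattice G) R"
    using ex_transversal_mult[OF G(2) N(1,3)] by auto
  have GN: "dim_row (G * N) = length rs" using G(1) by simp
  have BK: "boundaries (d - 1) K = chain_of rs ` col_lattice G"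
    using boundaries_enum(1)[OF fs order_refl] G(3) by simp
  have BL: "boundaries (d - 1) L = chain_of rs ` col_lattice (G * N)"
    using boundaries_enum(1)[OF gs L] N(2) by simp
  have sub: "col_lattice (G * N) \<subseteq> col_lattice G"
  proof -
    have "col_lattice N \<subseteq> carrier_vec (dim_col G)"
      using int_subgroup_col_lattice[of N] N(1) by (auto simp: int_subgroup_def)
    thus ?thesis unfolding col_lattice_mult[OF N(1)] unfolding col_lattice_def[of G] by blast
  qed
  have "int_subgroup (length rs) (col_lattice (G * N))" "int_subgroup (length rs) (col_lattice G)"
    using int_subgroup_col_lattice[of "G * N"] int_subgroup_col_lattice[of G] GN G(1) by simp_all
  note tr = transversal_chain_of[OF distinct_rs this R(2)]
  have "Coset.order (boundaries_quotient (d - 1) K L) = card (chain_of rs ` R)"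
    unfolding boundaries_quotient_def BK BL chain_group_def
    by (rule order_frag_quotient[OF frag_subgroup_lattice[OF G(1)] frag_subgroup_lattice[OF GN] image_mono[OF sub] tr(1)])
  thus ?thesis using tr(2) R(1) by simp
qed

lemma card_torsion_reduced_homology:
  assumes F: "basis_mat (length rs) F (span_lattice (incidence_mat rs fs))"
    and M: "M \<in> carrier_mat (dim_col F) (dim_col F)"
    and G: "basis_mat (length rs) (F * M) (col_lattice (incidence_mat rs fs))"
  shows "int (card (torsion (reduced_homology (d - 1) K))) = \<bar>det M\<bar>" and "det M \<noteq> 0"
proof -
  let ?U = "incidence_mat rs fs"
  have F: "dim_row F = length rs" "inj_mat F" "col_lattice F = span_lattice ?U"
    using F by (auto simp: basis_mat_iff)
  have G: "inj_mat (F * M)" "col_lattice (F * M) = col_lattice ?U"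
    using G by (auto simp: basis_mat_iff)
  show det: "det M \<noteq> 0" using inj_mat_multD[OF G(1) M] inj_mat_iff_det[OF M] by simp
  obtain R where R: "int (card R) = \<bar>det M\<bar>" "transversal (col_lattice ?U) (span_lattice ?U) R"
    using ex_transversal_mult[OF F(2) M det] F(3) G(2) by auto
  have subg: "int_subgroup (length rs) (col_lattice ?U)" "int_subgroup (length rs) (span_lattice ?U)"
    using int_subgroup_col_lattice[of ?U] int_subgroup_span_lattice[of ?U] by simp_all
  note tr = transversal_chain_of[OF distinct_rs subg R(2)]
  let ?A = "cycles (d - 1) K" and ?N = "chain_of rs ` col_lattice ?U"
  have A: "?A = {c. Poly_Mapping.keys c \<subseteq> faces (d - 1) K \<and> boundary c = 0}"
    by (auto simp: cycles_def kernel_def chain_group_def)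
  have B: "boundaries (d - 1) K = ?N" using boundaries_enum(1)[OF fs order_refl] .
  have Afrag: "frag_subgroup (faces (d - 1) K) ?A"
    unfolding frag_subgroup_def A
    using keys_diff by (fastforce simp: boundary_def frag_extend_diff)
  have Nfrag: "frag_subgroup (faces (d - 1) K) ?N" by (rule frag_subgroup_lattice) simp
  have bb: "boundary c = 0" if "c \<in> ?N" for c
  proof -
    have "c \<in> boundary ` carrier (chain_group d K)" using that unfolding B[symmetric] boundaries_def by simp
    then obtain b where b: "Poly_Mapping.keys b \<subseteq> faces d K" "c = boundary b"
      by (auto simp: carrier_chain_group)
    show ?thesis unfolding b(2) using b(1) finite_face by (intro boundary_boundary) (auto simp: faces_def)
  qed
  have NA: "?N \<subseteq> ?A" using bb Nfrag by (auto simp: A frag_subgroup_def)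
  have "{a \<in> ?A. \<exists>m::nat. 0 < m \<and> frag_cmul (int m) a \<in> ?N} = chain_of rs ` span_lattice ?U"
  proof (intro equalityI subsetI)
    fix a assume "a \<in> {a \<in> ?A. \<exists>m::nat. 0 < m \<and> frag_cmul (int m) a \<in> ?N}"
    then obtain m :: nat where a: "Poly_Mapping.keys a \<subseteq> set rs" and m: "0 < m" "frag_cmul (int m) a \<in> ?N"
      by (auto simp: A set_rs)
    obtain v where v: "v \<in> carrier_vec (length rs)" "a = chain_of rs v"
      using a bij_betw_imp_surj_on[OF bij_betw_chain_of[OF distinct_rs]] by blast
    obtain w where w: "w \<in> col_lattice ?U" "frag_cmul (int m) a = chain_of rs w" using m(2) by blast
    have "chain_of rs (int m \<cdot>\<^sub>v v) = chain_of rs w" using chain_of_smult[OF v(1)] v(2) w(2) by simp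
    hence "int m \<cdot>\<^sub>v v = w"
      by (rule inj_onD[OF bij_betw_imp_inj_on[OF bij_betw_chain_of[OF distinct_rs]]])
        (use v(1) int_subgroup_carrier[OF subg(1) w(1)] in simp_all)
    hence "int m \<cdot>\<^sub>v v \<in> span_lattice ?U" using w(1) col_lattice_subset_span_lattice[of ?U] by blast
    moreover have "v \<in> carrier_vec (dim_row ?U)" "int m \<noteq> 0" using m(1) v(1) by simp_all
    ultimately have "v \<in> span_lattice ?U" using span_lattice_saturated by blast
    thus "a \<in> chain_of rs ` span_lattice ?U" using v(2) by blast
  next
    fix a assume "a \<in> chain_of rs ` span_lattice ?U"
    then obtain v where v: "v \<in> span_lattice ?U" "a = chain_of rs v" by blast
    have vc: "v \<in> carrier_vec (length rs)" using int_subgroup_carrier[OF subg(2) v(1)] .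
    have "det M \<cdot>\<^sub>v v \<in> col_lattice ?U" using col_lattice_mult_det[OF M, of v] v(1) F(3) G(2) by simp
    \<comment> \<open>Torsion asks for a positive multiplier, so the sign of the determinant is
      cleared.\<close>
    hence "sgn (det M) \<cdot>\<^sub>v (det M \<cdot>\<^sub>v v) \<in> col_lattice ?U" by (rule int_subgroup_smult[OF subg(1)])
    hence "\<bar>det M\<bar> \<cdot>\<^sub>v v \<in> col_lattice ?U" by (simp add: smult_smult_assoc abs_sgn mult.commute)
    hence "chain_of rs (\<bar>det M\<bar> \<cdot>\<^sub>v v) \<in> ?N" by (rule imageI)
    hence mem: "frag_cmul \<bar>det M\<bar> a \<in> ?N" using chain_of_smult[OF vc] v(2) by simp
    hence "boundary (frag_cmul \<bar>det M\<bar> a) = 0" by (rule bb)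
    \<comment> \<open>A nonzero multiple of \<open>a\<close> is a boundary, hence a cycle; chains
      being torsion-free, \<open>a\<close> itself is a cycle.\<close>
    hence "boundary a = 0" using det by (simp add: boundary_def frag_extend_cmul)
    moreover have "Poly_Mapping.keys a \<subseteq> faces (d - 1) K" unfolding v(2) set_rs[symmetric] by (rule keys_chain_of)
    ultimately have "a \<in> ?A" by (simp add: A)
    moreover have "0 < nat \<bar>det M\<bar>" "frag_cmul (int (nat \<bar>det M\<bar>)) a \<in> ?N" using det mem by simp_all
    ultimately show "a \<in> {a \<in> ?A. \<exists>m::nat. 0 < m \<and> frag_cmul (int m) a \<in> ?N}" by blast
  qed
  hence "card (torsion (reduced_homology (d - 1) K)) = card ((\<lambda>a. (\<lambda>n. n + a) ` ?N) ` chain_of rs ` span_lattice ?U)"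
    unfolding reduced_homology_def B chain_group_def torsion_frag_quotient[OF Afrag Nfrag NA] by simp
  also have "\<dots> = card (chain_of rs ` R)"
    by (rule card_cosets[OF _ _ tr(1)]) (use Nfrag in \<open>auto simp: frag_subgroup_def\<close>)
  finally show "int (card (torsion (reduced_homology (d - 1) K))) = \<bar>det M\<bar>" using tr(2) R(1) by simp
qed

section \<open>Subcomplexes with the full skeleton below dimension d\<close>

text \<open>Indexing by sets of column positions lets the sum over forests be matched with the sum
  over sets of columns.\<close>

definition subcomplex :: "nat set \<Rightarrow> 'v set set" where
  "subcomplex I = skeleton (d - 1) K \<union> (\<lambda>i. fs ! i) ` I"

lemma face_dim_fs: "i < length fs \<Longrightarrow> fs ! i \<in> K \<and> face_dim (fs ! i) = d"
  using nth_mem[of i fs] set_fs by (auto simp: faces_def)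

lemma subcomplex_subset: "I \<subseteq> {..<length fs} \<Longrightarrow> subcomplex I \<subseteq> K"
  using face_dim_fs by (auto simp: subcomplex_def skeleton_def)

lemma faces_subcomplex: "I \<subseteq> {..<length fs} \<Longrightarrow> faces d (subcomplex I) = (\<lambda>i. fs ! i) ` I"
  using face_dim_fs by (auto simp: subcomplex_def skeleton_def faces_def)

lemma skeleton_subcomplex: "I \<subseteq> {..<length fs} \<Longrightarrow> skeleton (d - 1) (subcomplex I) = skeleton (d - 1) K"
  using face_dim_fs by (fastforce simp: subcomplex_def skeleton_def)

text \<open>A proper subset of a face has dimension at most \<open>d - 1\<close> and therefore lies
  in the skeleton, whichever facets are chosen.\<close>

lemma abstract_complex_subcomplex:
  assumes I: "I \<subseteq> {..<length fs}"
  shows "abstract_complex (subcomplex I)"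
  unfolding abstract_complex_def
proof (intro conjI ballI allI impI)
  show "finite (subcomplex I)"
    using subcomplex_subset[OF I] K finite_subset by (auto simp: abstract_complex_def)
  fix \<sigma> assume \<sigma>: "\<sigma> \<in> subcomplex I"
  hence \<sigma>K: "\<sigma> \<in> K" using subcomplex_subset[OF I] by blast
  show fin: "finite \<sigma>" by (rule finite_face[OF \<sigma>K])
  fix \<tau> assume \<tau>: "\<tau> \<subseteq> \<sigma>"
  hence \<tau>K: "\<tau> \<in> K" using \<sigma>K K by (auto simp: abstract_complex_def)
  show "\<tau> \<in> subcomplex I"
  proof (cases "\<tau> = \<sigma>")
    case False
    hence "card \<tau> < card \<sigma>" using \<tau> fin by (intro psubset_card_mono) auto
    hence "face_dim \<tau> \<le> d - 1" using face_dim_le[OF \<sigma>K] by (simp add: face_dim_def)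
    thus ?thesis using \<tau>K by (simp add: subcomplex_def skeleton_def)
  qed (use \<sigma> in simp)
qed

lemma inj_on_subcomplex: "inj_on subcomplex {I. I \<subseteq> {..<length fs}}"
proof (rule inj_onI)
  fix I J assume IJ: "I \<in> {I. I \<subseteq> {..<length fs}}" "J \<in> {I. I \<subseteq> {..<length fs}}" "subcomplex I = subcomplex J"
  have "(\<lambda>i. fs ! i) ` I = (\<lambda>i. fs ! i) ` J"
    using faces_subcomplex IJ by (metis mem_Collect_eq)
  moreover have "inj_on (\<lambda>i. fs ! i) {..<length fs}" by (rule inj_on_nth[OF distinct_fs]) simp
  ultimately show "I = J" using inj_on_image_eq_iff[of "\<lambda>i. fs ! i" "{..<length fs}" I J] IJ(1,2) by simp
qed

text \<open>No face of \<open>K\<close> exceeds dimension \<open>d\<close>, so a subcomplex with the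
  prescribed skeleton is determined by the facets it contains.\<close>

lemma forest_imp_subcomplex:
  assumes "kappa_forest \<kappa> d K L"
  shows "\<exists>I\<subseteq>{..<length fs}. L = subcomplex I"
proof -
  have L: "L \<subseteq> K" "skeleton (d - 1) L = skeleton (d - 1) K" using assms by (auto simp: kappa_forest_def)
  let ?I = "{i. i < length fs \<and> fs ! i \<in> L}"
  have "L = subcomplex ?I"
  proof (intro equalityI subsetI)
    fix \<sigma> assume \<sigma>: "\<sigma> \<in> L"
    hence \<sigma>K: "\<sigma> \<in> K" using L by blast
    show "\<sigma> \<in> subcomplex ?I"
    proof (cases "face_dim \<sigma> = d")
      case True
      hence "\<sigma> \<in> set fs" using \<sigma>K set_fs by (simp add: faces_def)
      then obtain i where "i < length fs" "fs ! i = \<sigma>" by (auto simp: in_set_conv_nth)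
      thus ?thesis using \<sigma> by (auto simp: subcomplex_def)
    next
      case False
      hence "face_dim \<sigma> \<le> d - 1" using face_dim_le[OF \<sigma>K] by simp
      thus ?thesis using \<sigma>K by (simp add: subcomplex_def skeleton_def)
    qed
  next
    fix \<sigma> assume "\<sigma> \<in> subcomplex ?I"
    moreover have "skeleton (d - 1) K \<subseteq> L" unfolding L(2)[symmetric] by (auto simp: skeleton_def)
    ultimately show "\<sigma> \<in> L" by (auto simp: subcomplex_def)
  qed
  moreover have "?I \<subseteq> {..<length fs}" by auto
  ultimately show ?thesis by (intro exI[of _ ?I] conjI)
qed

text \<open>Absence of cycles is injectivity of the selected columns. By rank-nullity the number of
  facets minus the rank of the cycle group is r, so the count of facets says \<open>card I\<close>
  is r. The rank condition then follows, because independent columns have rank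
  \<open>card I\<close>.\<close>

lemma forest_subcomplex_iff:
  assumes I: "I \<subseteq> {..<length fs}"
  shows "kappa_forest 0 d K (subcomplex I) \<longleftrightarrow>
    card I = mat_rank (incidence_mat rs fs) \<and> inj_mat (incidence_mat rs (col_list fs I))"
proof -
  let ?U = "incidence_mat rs fs" and ?gs = "col_list fs I" and ?L = "subcomplex I"
  let ?V = "incidence_mat rs ?gs"
  have gs: "enumerates ?gs (faces d ?L)"
    using enumerates_col_list[OF distinct_fs I] faces_subcomplex[OF I] by simp
  have sub: "faces d ?L \<subseteq> faces d K" using subcomplex_subset[OF I] by (auto simp: faces_def)
  have dgs: "distinct ?gs" using gs by (simp add: enumerates_def)
  have cyc: "cycles d ?L = {0} \<longleftrightarrow> inj_mat ?V"
  proof -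
    let ?Z = "{v \<in> carrier_vec (card I). ?V *\<^sub>v v = 0\<^sub>v (length rs)}"
    have Z: "cycles d ?L = chain_of ?gs ` ?Z" using boundaries_enum(3)[OF gs sub] by simp
    have z0: "0\<^sub>v (card I) \<in> ?Z" using incidence_mat_zero[of rs ?gs] by simp
    have c0: "chain_of ?gs (0\<^sub>v (card I)) = 0" using chain_of_zero[of ?gs] by simp
    show ?thesis
    proof
      assume c: "cycles d ?L = {0}"
      show "inj_mat ?V" unfolding inj_mat_def
      proof (intro ballI impI)
        fix v assume v: "v \<in> carrier_vec (dim_col ?V)" "?V *\<^sub>v v = 0\<^sub>v (dim_row ?V)"
        hence "chain_of ?gs v \<in> cycles d ?L" unfolding Z by simp
        hence "chain_of ?gs v = 0" unfolding c by simp
        thus "v = 0\<^sub>v (dim_col ?V)" using chain_of_eq_0D[OF dgs, of v] v(1) by simp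
      qed
    next
      assume inj: "inj_mat ?V"
      have "?Z = {0\<^sub>v (card I)}" using inj z0 unfolding inj_mat_def by auto
      thus "cycles d ?L = {0}" unfolding Z using c0 by simp
    qed
  qed
  obtain G where G: "basis_mat (dim_row ?U) G (col_lattice ?U)"
    using ex_basis_mat[OF int_subgroup_col_lattice] by blast
  have rG: "dim_col G = mat_rank ?U"
    by (rule basis_mat_dim_col[OF G order_refl col_lattice_subset_span_lattice])
  have "basis_mat (length rs) G (col_lattice ?U)" using G by simp
  hence rK: "boundary_rank d K = mat_rank ?U"
    using boundaries_enum(2)[OF fs order_refl] chain_rank_chain_of[OF distinct_rs] rG by metis
  let ?Z = "{v \<in> carrier_vec (length fs). ?U *\<^sub>v v = 0\<^sub>v (length rs)}"
  have "int_subgroup (length fs) ?Z"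
    unfolding int_subgroup_def
  proof (intro conjI ballI)
    show "0\<^sub>v (length fs) \<in> ?Z" using incidence_mat_zero[of rs fs] by simp
    fix u v assume uv: "u \<in> ?Z" "v \<in> ?Z"
    have "?U *\<^sub>v (u - v) = ?U *\<^sub>v u - ?U *\<^sub>v v"
      by (rule mult_minus_distrib_mat_vec[OF carrier_mat_dims]) (use uv in simp_all)
    also have "\<dots> = 0\<^sub>v (length rs)" using uv by auto
    finally show "u - v \<in> ?Z" using uv by simp
  qed auto
  then obtain Q where Q: "basis_mat (length fs) Q ?Z" using ex_basis_mat by blast
  have "chain_rank (cycles d K) = dim_col Q"
    unfolding boundaries_enum(3)[OF fs order_refl] by (rule chain_rank_chain_of[OF distinct_fs Q])
  moreover have "dim_col G + dim_col Q = length fs" using rank_nullity[OF G, of Q] Q by simp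
  ultimately have rZ: "int (chain_rank (cycles d K)) = int (length fs) - int (mat_rank ?U)" using rG by simp
  have cK: "card (faces d K) = length fs" using distinct_card[OF distinct_fs] set_fs by simp
  have cL: "card (faces d ?L) = card I"
    using distinct_card[OF dgs] gs by (simp add: enumerates_def)
  have rL: "boundary_rank d ?L = card I" if "inj_mat ?V"
  proof -
    have "basis_mat (length rs) ?V (col_lattice ?V)" using that by (simp add: basis_mat_iff)
    thus ?thesis using boundaries_enum(2)[OF gs sub] chain_rank_chain_of[OF distinct_rs] by fastforce
  qed
  show ?thesis
    unfolding kappa_forest_def cyc rK rZ cK cL
    using abstract_complex_subcomplex[OF I] subcomplex_subset[OF I] skeleton_subcomplex[OF I] rL by auto
qed

end

section \<open>Powers and the final comparison of sums\<close>

text \<open>Valid for exponent 0 as well: a product vanishes exactly when one of its factors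
  does.\<close>

lemma zpow_mult: "zpow (a * b) k = zpow a k * zpow b k"
  by (simp add: zpow_def power_mult_distrib)

lemma zpow_nonzero: "a \<noteq> 0 \<Longrightarrow> zpow a k \<noteq> 0"
  by (simp add: zpow_def)

lemma poly_const_mult: "poly_const a * poly_const b = poly_const (a * b)"
  by (simp add: poly_const_def mult_single)

lemma poly_const_0: "poly_const 0 = 0"
  by (simp add: poly_const_def)

theorem theorem3p7:
  fixes \<Delta> :: "'v::linorder set set" and d :: int and k :: nat
    and ridges facets :: "'v set list"
  assumes "abstract_complex \<Delta>" and "\<Delta> \<noteq> {}" and "complex_dim \<Delta> = d"
    and "enumerates ridges (faces (d - 1) \<Delta>)"
    and "enumerates facets (faces d \<Delta>)"
    and "even k"
  shows "kirchhoff k ridges facets =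
    poly_const (zpow (real (card (torsion (reduced_homology (d - 1) \<Delta>)))) k) *
    (\<Sum>\<Gamma> | kappa_forest 0 d \<Delta> \<Gamma>.
       poly_const (zpow (real (Coset.order (boundaries_quotient (d - 1) \<Delta> \<Gamma>))) k) *
       (\<Prod>\<delta>\<in>faces d \<Gamma>. poly_var \<delta>))"
proof -
  note cplx = assms(1,3-5)
  let ?U = "incidence_mat ridges facets" and ?n = "length facets"
  let ?V = "\<lambda>I. incidence_mat ridges (col_list facets I)"
  let ?r = "mat_rank ?U" and ?sub = "subcomplex \<Delta> d facets"
  \<comment> \<open>The very basis selected inside \<open>lattice_norm\<close>, so the normalizing
    factor is literally built from \<open>gram_norm F\<close>.\<close>
  define F where "F = (SOME F. basis_mat (length ridges) F (span_lattice ?U))"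
  have F: "basis_mat (length ridges) F (span_lattice ?U)" unfolding F_def
    by (rule someI_ex, rule ex_basis_mat) (use int_subgroup_span_lattice[of ?U] in simp)
  obtain G where G: "basis_mat (length ridges) G (col_lattice ?U)"
    using ex_basis_mat[OF int_subgroup_col_lattice[of ?U]] by auto
  have rF: "dim_col F = ?r"
    by (rule basis_mat_dim_col[OF _ col_lattice_subset_span_lattice order_refl]) (simp add: F)
  have rG: "dim_col G = ?r"
    by (rule basis_mat_dim_col[OF _ order_refl col_lattice_subset_span_lattice]) (simp add: G)
  have F': "dim_row F = length ridges" "inj_mat F" "col_lattice F = span_lattice ?U"
    and G': "dim_row G = length ridges" "inj_mat G" "col_lattice G = col_lattice ?U"
    using F G by (auto simp: basis_mat_iff)
  have colG: "col G j \<in> col_lattice F" if "j < dim_col G" for j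
    using col_in_col_lattice[OF that] F'(3) G'(3) col_lattice_subset_span_lattice[of ?U] by auto
  obtain M where M: "M \<in> carrier_mat (dim_col F) (dim_col G)" "G = F * M"
    using col_lattice_factor[of G F, OF _ colG] F'(1) G'(1) by metis
  have Mc: "M \<in> carrier_mat (dim_col F) (dim_col F)" using M(1) rF rG by simp
  have tor: "int (card (torsion (reduced_homology (d - 1) \<Delta>))) = \<bar>det M\<bar>" and detM: "det M \<noteq> 0"
    using card_torsion_reduced_homology[OF cplx F Mc] G M(2) by simp_all
  have gG: "gram_norm G = real_of_int \<bar>det M\<bar> * gram_norm F"
    using gram_norm_mult[OF Mc] M(2) by simp
  have gF: "gram_norm F \<noteq> 0" by (rule gram_norm_nonzero[OF F'(2)])
  let ?T = "real (card (torsion (reduced_homology (d - 1) \<Delta>)))"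
  have T: "?T = real_of_int \<bar>det M\<bar>" using tor by (metis of_int_of_nat_eq)
  let ?Q = "\<lambda>L. real (Coset.order (boundaries_quotient (d - 1) \<Delta> L))"

  \<comment> \<open>The comparison of coefficients: the norm of the selected columns is |det N| |det
    M| times the norm of \<open>F\<close>, and the last factor cancels against the
    normalization.\<close>
  have coeff: "inverse (zpow (gram_norm F) k) * zpow (gram_norm (?V I)) k =
      (if inj_mat (?V I) then zpow ?T k * zpow (?Q (?sub I)) k else 0)"
    if I: "I \<subseteq> {..<?n}" "card I = ?r" for I
  proof -
    have dV: "dim_row (?V I) = dim_row G" "dim_col (?V I) = dim_col G" using I G'(1) rG by simp_all
    have gs: "enumerates (col_list facets I) (faces d (?sub I))"
      using enumerates_col_list[of facets I] faces_subcomplex[OF cplx I(1)] I(1) assms(5)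
      by (simp add: enumerates_def)
    have sub: "faces d (?sub I) \<subseteq> faces d \<Delta>"
      using subcomplex_subset[OF cplx I(1)] by (auto simp: faces_def)
    have colV: "col (?V I) j \<in> col_lattice G" if j: "j < dim_col (?V I)" for j
    proof -
      have p: "pick I j < ?n" using pick_in_set_le[of j I] I(1) j by auto
      have "col (?V I) j = col ?U (pick I j)"
        by (rule eq_vecI) (use j p in \<open>simp_all add: incidence_mat_def col_list_def\<close>)
      thus ?thesis using col_in_col_lattice[of "pick I j" ?U] p G'(3) by simp
    qed
    obtain N where N: "N \<in> carrier_mat (dim_col G) (dim_col (?V I))" "?V I = G * N"
      using col_lattice_factor[of "?V I" G, OF dV(1) colV] by metis
    have Nc: "N \<in> carrier_mat (dim_col G) (dim_col G)" using N(1) unfolding dV(2) .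
    have inj: "inj_mat (?V I) \<longleftrightarrow> det N \<noteq> 0"
      unfolding N(2) inj_mat_mult[OF G'(2) Nc] by (rule inj_mat_iff_det[OF Nc])
    have gV: "gram_norm (?V I) = real_of_int \<bar>det N\<bar> * ?T * gram_norm F"
      using gram_norm_mult[OF Nc] N(2) gG T by simp
    show ?thesis
    proof (cases "inj_mat (?V I)")
      case True
      hence "int (Coset.order (boundaries_quotient (d - 1) \<Delta> (?sub I))) = \<bar>det N\<bar>"
        using order_boundaries_quotient[OF cplx G gs sub Nc N(2)] inj by simp
      hence "?Q (?sub I) = real_of_int \<bar>det N\<bar>" by (metis of_int_of_nat_eq)
      thus ?thesis using True zpow_nonzero[OF gF, of k] unfolding gV zpow_mult by simp
    next
      \<comment> \<open>Dependent columns give \<open>det N = 0\<close> and norm 0;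
        \<open>zpow\<close> then returns 0 even for exponent 0.\<close>
      case False
      hence "gram_norm (?V I) = 0" using gV inj by simp
      thus ?thesis using False by (simp add: zpow_def)
    qed
  qed

  let ?S = "{I. I \<subseteq> {..<?n} \<and> card I = ?r}"
  let ?J = "{I. I \<subseteq> {..<?n} \<and> card I = ?r \<and> inj_mat (?V I)}"
  let ?x = "\<lambda>L. \<Prod>\<delta>\<in>faces d L. poly_var \<delta> :: 'v set mpoly"
  have finS: "finite ?S" by (rule finite_subset[of _ "Pow {..<?n}"]) auto
  have prod: "(\<Prod>i\<in>I. poly_var (facets ! i)) = ?x (?sub I)" if "I \<subseteq> {..<?n}" for I
  proof -
    have "inj_on (\<lambda>i. facets ! i) I"
      by (rule inj_on_nth) (use that assms(5) in \<open>auto simp: enumerates_def\<close>)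
    thus ?thesis unfolding faces_subcomplex[OF cplx that] by (simp add: prod.reindex)
  qed
  have bij: "bij_betw ?sub ?J {\<Gamma>. kappa_forest 0 d \<Delta> \<Gamma>}"
  proof (rule bij_betw_imageI)
    show "inj_on ?sub ?J" by (rule inj_on_subset[OF inj_on_subcomplex[OF cplx]]) blast
    show "?sub ` ?J = {\<Gamma>. kappa_forest 0 d \<Delta> \<Gamma>}"
    proof (intro equalityI subsetI)
      fix L assume "L \<in> ?sub ` ?J"
      thus "L \<in> {\<Gamma>. kappa_forest 0 d \<Delta> \<Gamma>}" using forest_subcomplex_iff[OF cplx] by auto
    next
      fix L assume "L \<in> {\<Gamma>. kappa_forest 0 d \<Delta> \<Gamma>}"
      hence L: "kappa_forest 0 d \<Delta> L" by simp
      then obtain I where I: "I \<subseteq> {..<?n}" "L = ?sub I" using forest_imp_subcomplex[OF cplx] by blast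
      thus "L \<in> ?sub ` ?J" using forest_subcomplex_iff[OF cplx I(1)] L by blast
    qed
  qed
  have "kirchhoff k ridges facets = poly_const (inverse (zpow (gram_norm F) k)) *
      (\<Sum>I\<in>?S. poly_const (zpow (gram_norm (submatrix ?U UNIV I)) k) * (\<Prod>i\<in>I. poly_var (facets ! i)))"
    unfolding kirchhoff_def kirchhoff_mat_def lattice_norm_def by (simp add: F_def)
  also have "\<dots> = (\<Sum>I\<in>?S. poly_const (inverse (zpow (gram_norm F) k)) *
      (poly_const (zpow (gram_norm (submatrix ?U UNIV I)) k) * (\<Prod>i\<in>I. poly_var (facets ! i))))"
    by (rule sum_distrib_left)
  also have "\<dots> = (\<Sum>I\<in>?S. if inj_mat (?V I)
      then poly_const (zpow ?T k) * (poly_const (zpow (?Q (?sub I)) k) * ?x (?sub I)) else 0)"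
  proof (rule sum.cong[OF refl])
    fix I assume "I \<in> ?S"
    hence I: "I \<subseteq> {..<?n}" "card I = ?r" by simp_all
    show "poly_const (inverse (zpow (gram_norm F) k)) *
      (poly_const (zpow (gram_norm (submatrix ?U UNIV I)) k) * (\<Prod>i\<in>I. poly_var (facets ! i))) =
      (if inj_mat (?V I)
      then poly_const (zpow ?T k) * (poly_const (zpow (?Q (?sub I)) k) * ?x (?sub I)) else 0)"
      unfolding submatrix_incidence_mat[OF I(1)] prod[OF I(1)] mult.assoc[symmetric] poly_const_mult coeff[OF I]
      by (simp add: poly_const_0)
  qed
  \<comment> \<open>The index sets with dependent columns contribute 0; those that remain are in
    bijection with the 0-forests.\<close>
  also have "\<dots> = (\<Sum>I\<in>?J. poly_const (zpow ?T k) * (poly_const (zpow (?Q (?sub I)) k) * ?x (?sub I)))"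
    by (rule sum.mono_neutral_cong_right[OF finS]) auto
  also have "\<dots> = (\<Sum>\<Gamma> | kappa_forest 0 d \<Delta> \<Gamma>.
      poly_const (zpow ?T k) * (poly_const (zpow (?Q \<Gamma>) k) * ?x \<Gamma>))"
    by (rule sum.reindex_bij_betw[OF bij])
  also have "\<dots> = poly_const (zpow ?T k) * (\<Sum>\<Gamma> | kappa_forest 0 d \<Delta> \<Gamma>. poly_const (zpow (?Q \<Gamma>) k) * ?x \<Gamma>)"
    by (rule sum_distrib_left[symmetric])
  finally show ?thesis .
qed

end
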